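(* Let $A,B$ be integers and let $U=(U_n)_{n\ge 0}$ be the Lucas sequence defined by $U_0=0$, $U_1=1$, $U_n=AU_{n-1}-BU_{n-2}$ $(n\ge 2)$. Let $\alpha,\beta$ be the roots of $x^2-Ax+B$, labelled so that $|\alpha|\ge|\beta|$, and assume $U$ is non-degenerate, i.e. $AB\neq 0$ and $\alpha/\beta$ is not a root of unity. Then for every $n\ge 2$ the following hold. (Real case $A^2>4B$.) If $B<0$ then $|U_n|\ge \frac{|\alpha|^{n-2}}{2}$; if $A^2>4B>0$ then $|U_n|\ge |\alpha|^{n-1}$. (Non-real case $A^2<4B$.) If $B\le 535$ then $$|U_n|\ge \begin{cases}\frac14 e^{-250(\log n)^2}|\alpha|^{n-2}, & n>5\cdot 10^8,\\ \frac14 e^{-100000}|\alpha|^{n-2}, & n\le 5\cdot 10^8,\end{cases}$$ and if $B\ge 536$ then $$|U_n|\ge \begin{cases}\frac14 |\alpha|^{n-2-88(\log n)^2}, & n>2.1\cdot 10^8,\\ \frac14 |\alpha|^{n-31710}, & n\le 2.1\cdot 10^8.\end{cases}$$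
   Context: $\log$ denotes the natural logarithm. In the non-real case $\alpha,\beta$ are complex conjugates and $|\alpha|=\sqrt B$. *)

theory Defs
  imports Complex_Main "HOL-Computational_Algebra.Polynomial"
begin

fun lucas_U :: "int \<Rightarrow> int \<Rightarrow> nat \<Rightarrow> int" where
  "lucas_U A B 0 = 0"
| "lucas_U A B (Suc 0) = 1"
| "lucas_U A B (Suc (Suc n)) = A * lucas_U A B (Suc n) - B * lucas_U A B n"

text \<open>The ordered pair \<open>\<alpha>, \<beta>\<close> lists the complex roots of \<open>x\<^sup>2 - A x + B\<close> with multiplicity.\<close>

definition char_roots :: "int \<Rightarrow> int \<Rightarrow> complex \<Rightarrow> complex \<Rightarrow> bool" where
  "char_roots A B \<alpha> \<beta> \<longleftrightarrow>
     [:complex_of_int B, - complex_of_int A, 1:] = [:- \<alpha>, 1:] * [:- \<beta>, 1:]"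

definition root_of_unity :: "complex \<Rightarrow> bool" where
  "root_of_unity z \<longleftrightarrow> (\<exists>k::nat. k \<ge> 1 \<and> z ^ k = 1)"

definition nondegenerate :: "int \<Rightarrow> int \<Rightarrow> complex \<Rightarrow> complex \<Rightarrow> bool" where
  "nondegenerate A B \<alpha> \<beta> \<longleftrightarrow> A * B \<noteq> 0 \<and> \<not> root_of_unity (\<alpha> / \<beta>)"

end

theory Submission
  imports "HOL-Analysis.Complex_Transcendental" "Jordan_Normal_Form.Determinant" Defs
begin

text \<open>In the real case \<open>U\<^sub>n = (\<alpha>\<^sup>n - \<beta>\<^sup>n) / (\<alpha> - \<beta>)\<close> has no cancellation. In the non-real case write
  \<open>\<alpha> / \<beta> = e\<^bsup>i\<phi>\<^esup>\<close>; everything reduces to a lower bound for \<open>\<Lambda> = n \<phi> - k \<pi>\<close>, proved by the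
  interpolation determinant method of Laurent. If \<open>\<Lambda>\<close> is tiny, then at the points
  \<open>r \<phi> + s \<pi> \<approx> (\<pi> / n) (r k + s n)\<close> the functions \<open>binom (n z / \<pi>, \<kappa>) e\<^bsup>i l z\<^esup>\<close> almost take algebraic values.
  A zero estimate provides a nonvanishing determinant of such values; after clearing denominators it lies
  in \<open>\<int>[\<alpha>]\<close>, a lattice whose nonzero elements have absolute value at least 1. On the other hand,
  expanding the functions in Chebyshev polynomials on the real interval containing the points shows that
  the determinant is less than 1. The Chebyshev expansion replaces the usual Schwarz lemma on discs and
  gains about a factor 2 in the radius, which is what makes the constants fit comfortably.\<close>

section \<open>Determinants of functions with decaying Chebyshev coefficients\<close>

text \<open>All sizes are tied together by one budget. Put N = KL = 25cp(2p+1), with p about (log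
  n)/2 and c about log B (but at least 7). The assumed smallness is |\<Lambda>| \<le> e^(-2N-p), so
  the final bound is of order log B (log n)^2 in the exponent. With Bernstein parameter e^2,
  replacing angles by exact multiples of \<pi>/n costs no more than cutting the expansion after N
  terms, and the determinant gains e^(-N(N-1)). Against this stand about e^(N^2/2) from the
  binomials, where n \<le> e^(2p) enters, at most e^(0.46 N^2) from the exponentials and the
  clearing of denominators, and factors of size e^(O(N log N)). Binomials replace powers because
  they are integers at the nodes while their factorial denominators offset the size of the interval.
  A further obstacle is that k and n may have a common factor, so that distinct points could share a
  node rk + sn. A Liouville inequality for \<phi> rules this out in the range that the zero estimate
  uses.\<close>

lemma nonzero_minor:
  fixes g :: "nat \<Rightarrow> 'a \<Rightarrow> 'b::idom"
  assumes "\<And>c. \<exists>i<n. c i \<noteq> 0 \<Longrightarrow> \<exists>x\<in>X. (\<Sum>i<n. c i * g i x) \<noteq> 0"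
  shows "\<exists>xs. (\<forall>j<n. xs j \<in> X) \<and> det (mat n n (\<lambda>(i, j). g i (xs j))) \<noteq> 0"
  using assms
proof (induction n)
  case 0
  show ?case by (auto simp: det_dim_zero[of "mat 0 0 _"])
next
  case (Suc n)
  have "\<exists>x\<in>X. (\<Sum>i<n. c i * g i x) \<noteq> 0" if "\<exists>i<n. c i \<noteq> 0" for c :: "nat \<Rightarrow> 'b"
  proof -
    from that have "\<exists>i<Suc n. (c(n := 0)) i \<noteq> 0" by (metis fun_upd_other less_Suc_eq less_irrefl)
    from Suc.prems[OF this] show ?thesis by (auto cong: sum.cong_simp)
  qed
  from Suc.IH[OF this] obtain xs where xs: "\<forall>j<n. xs j \<in> X"
    and det: "det (mat n n (\<lambda>(i, j). g i (xs j))) \<noteq> 0" by auto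
  define M where "M x = mat (Suc n) (Suc n) (\<lambda>(i, j). g i ((xs(n := x)) j))" for x
  \<comment> \<open>The cofactors along the last column do not depend on the point placed there, so
    \<open>det (M x)\<close> is a linear combination of the \<open>g i x\<close>. Its last
    coefficient is the minor from the induction hypothesis, hence the combination is
    nontrivial.\<close>
  define c where "c i = cofactor (M undefined) i n" for i
  have cof: "cofactor (M x) i n = c i" if "i < Suc n" for x i
  proof -
    have "mat_delete (M x) i n = mat_delete (M undefined) i n"
      by (rule eq_matI) (auto simp: M_def mat_delete_def)
    thus ?thesis by (simp add: c_def cofactor_def)
  qed
  have "mat_delete (M undefined) n n = mat n n (\<lambda>(i, j). g i (xs j))"
    by (rule eq_matI) (auto simp: M_def mat_delete_def)
  hence "c n \<noteq> 0" using det by (simp add: c_def cofactor_def)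
  then obtain x where x: "x \<in> X" "(\<Sum>i<Suc n. c i * g i x) \<noteq> 0"
    using Suc.prems[of c] by blast
  have "det (M x) = (\<Sum>i<Suc n. M x $$ (i, n) * cofactor (M x) i n)"
    by (rule laplace_expansion_column) (auto simp: M_def)
  also have "\<dots> = (\<Sum>i<Suc n. c i * g i x)"
  proof (rule sum.cong[OF refl])
    fix i assume "i \<in> {..<Suc n}"
    moreover from this have "M x $$ (i, n) = g i x" by (simp add: M_def)
    ultimately show "M x $$ (i, n) * cofactor (M x) i n = c i * g i x" by (simp add: cof)
  qed
  finally have "det (M x) \<noteq> 0" using x by simp
  thus ?case using x xs by (intro exI[of _ "xs(n := x)"]) (auto simp: M_def less_Suc_eq)
qed

lemma prod_index_mat_permutes:
  fixes f :: "nat \<Rightarrow> nat \<Rightarrow> 'a::comm_monoid_mult"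
  assumes "p permutes {0..<n}"
  shows "(\<Prod>i = 0..<n. mat n n (\<lambda>(i, j). f i j) $$ (i, p i)) = (\<Prod>i = 0..<n. f i (p i))"
  using permutes_in_image[OF assms] by (intro prod.cong) auto

text \<open>Distinct naturals cannot be packed lower than 0, 1, 2, ..., and the cap exceeds all of
  these. The cap is there because truncation errors decay only like the N-th power. In the induction
  on removing the maximum, which is at least \<open>card A - 1\<close>, the cap has to stay fixed
  while the cardinality drops, hence the auxiliary \<open>N\<close>.\<close>

lemma sum_min_ge:
  fixes A :: "nat set"
  assumes "finite A"
  shows "(\<Sum>i<card A. i) \<le> (\<Sum>x\<in>A. min x (card A))"
proof -
  have "(\<Sum>i<card A. i) \<le> (\<Sum>x\<in>A. min x N)" if "card A \<le> N" for N
    using assms that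
  proof (induction "card A" arbitrary: A)
    case 0 thus ?case by auto
  next
    case (Suc n)
    define m where "m = Max A"
    have ne: "A \<noteq> {}" using Suc.hyps by auto
    hence m: "m \<in> A" using Suc.prems m_def by auto
    have card: "card (A - {m}) = n" using Suc.hyps m Suc.prems by simp
    have "A \<subseteq> {..m}" using Suc.prems m_def by auto
    hence "card A \<le> Suc m" using card_mono[of "{..m}" A] by simp
    hence mn: "n \<le> min m N" using Suc.hyps Suc.prems by auto
    have "(\<Sum>i<card (A - {m}). i) \<le> (\<Sum>x\<in>A-{m}. min x N)"
      using Suc.hyps(1)[of "A - {m}"] card Suc.prems Suc.hyps(2) by simp
    thus ?case using mn m Suc.prems card by (simp add: sum.remove[of A m] flip: Suc.hyps(2))
  qed
  thus ?thesis by blast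
qed

lemma norm_det_le_fact:
  fixes t :: "nat \<Rightarrow> nat \<Rightarrow> complex"
  assumes "\<And>i j. i < n \<Longrightarrow> j < n \<Longrightarrow> norm (t i j) \<le> 1"
  shows "norm (det (mat n n (\<lambda>(i, j). t i j))) \<le> fact n"
proof -
  have "det (mat n n (\<lambda>(i, j). t i j)) = (\<Sum>p | p permutes {0..<n}. signof p * (\<Prod>i = 0..<n. t i (p i)))"
    unfolding det_def by (auto intro!: sum.cong prod.cong arg_cong2[of _ _ _ _ "(*)"] simp: permutes_in_image)
  also have "norm \<dots> \<le> (\<Sum>p | p permutes {0..<n}. norm (signof p * (\<Prod>i = 0..<n. t i (p i))))"
    by (rule norm_sum)
  also have "\<dots> \<le> (\<Sum>p | p permutes {0..<n}. 1)"
  proof (rule sum_mono)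
    fix p assume "p \<in> {p. p permutes {0..<n}}"
    hence p: "p permutes {0..<n}" by simp
    have "norm (\<Prod>i = 0..<n. t i (p i)) \<le> (\<Prod>i = 0..<n. 1)"
      unfolding prod_norm[symmetric]
      using permutes_in_image[OF p] by (intro prod_mono) (auto intro!: assms)
    thus "norm (signof p * (\<Prod>i = 0..<n. t i (p i))) \<le> 1"
      by (auto simp: norm_mult sign_def)
  qed
  also have "\<dots> = fact n" by (simp add: card_permutations[of _ n])
  finally show ?thesis .
qed

text \<open>Multilinearity in the rows: a Cauchy-Binet formula left as a sum over all maps
  \<open>g\<close> instead of over subsets.\<close>

lemma det_expand_rows:
  fixes F c t :: "nat \<Rightarrow> nat \<Rightarrow> 'a::comm_ring_1"
  assumes "\<And>i j. i < n \<Longrightarrow> j < n \<Longrightarrow> F i j = (\<Sum>m<M. c i m * t m j)"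
  shows "det (mat n n (\<lambda>(i, j). F i j)) =
    (\<Sum>g\<in>PiE {0..<n} (\<lambda>_. {..<M}).
      (\<Prod>i = 0..<n. c i (g i)) * det (mat n n (\<lambda>(i, j). t (g i) j)))"
proof -
  let ?P = "{p. p permutes {0..<n}}" and ?G = "PiE {0..<n} (\<lambda>_. {..<M})"
  note * = prod_index_mat_permutes
  have "det (mat n n (\<lambda>(i, j). F i j)) = (\<Sum>p\<in>?P. signof p * (\<Prod>i = 0..<n. F i (p i)))"
    unfolding det_def by (simp add: *)
  also have "\<dots> = (\<Sum>p\<in>?P. signof p * (\<Prod>i = 0..<n. \<Sum>m<M. c i m * t m (p i)))"
  proof (intro sum.cong refl arg_cong2[of _ _ _ _ "(*)"] prod.cong)
    fix p i assume "p \<in> ?P" "i \<in> {0..<n}"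
    thus "F i (p i) = (\<Sum>m<M. c i m * t m (p i))"
      using permutes_in_image[of p "{0..<n}" i] by (intro assms) auto
  qed
  also have "\<dots> = (\<Sum>p\<in>?P. \<Sum>g\<in>?G. signof p * (\<Prod>i = 0..<n. c i (g i) * t (g i) (p i)))"
    by (subst prod_sum_PiE) (auto simp: sum_distrib_left)
  also have "\<dots> = (\<Sum>g\<in>?G. \<Sum>p\<in>?P. signof p * (\<Prod>i = 0..<n. c i (g i) * t (g i) (p i)))"
    by (rule sum.swap)
  also have "\<dots> = (\<Sum>g\<in>?G. (\<Prod>i = 0..<n. c i (g i)) * det (mat n n (\<lambda>(i, j). t (g i) j)))"
    unfolding det_def by (simp add: * prod.distrib sum_distrib_left mult_ac)
  finally show ?thesis .
qed

text \<open>A map \<open>g\<close> with a repeated value yields two equal rows and contributes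
  nothing. In all other terms the indices are distinct, so their decay exponents add up to at least
  0 + 1 + ... + (n-1). This exponent, quadratic in n, is the whole gain of the method; the crude
  factors \<open>M ^ n\<close> and \<open>fact n\<close> are of lower order.\<close>

lemma norm_det_decay:
  fixes F c t :: "nat \<Rightarrow> nat \<Rightarrow> complex" and w :: real
  assumes F: "\<And>i j. i < n \<Longrightarrow> j < n \<Longrightarrow> F i j = (\<Sum>m<M. c i m * t m j)"
    and c: "\<And>i m. i < n \<Longrightarrow> m < M \<Longrightarrow> norm (c i m) \<le> C i * w ^ min m n"
    and t: "\<And>m j. m < M \<Longrightarrow> j < n \<Longrightarrow> norm (t m j) \<le> 1"
    and w: "0 \<le> w" "w \<le> 1" and C: "\<And>i. i < n \<Longrightarrow> C i \<ge> 0"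
  shows "norm (det (mat n n (\<lambda>(i, j). F i j)))
    \<le> real M ^ n * ((\<Prod>i<n. C i) * w ^ (\<Sum>i<n. i) * fact n)"
proof -
  let ?G = "PiE {0..<n} (\<lambda>_. {..<M})"
  let ?t = "\<lambda>g. det (mat n n (\<lambda>(i, j). t (g i) j))"
  let ?B = "(\<Prod>i<n. C i) * w ^ (\<Sum>i<n. i) * fact n"
  have "norm ((\<Prod>i = 0..<n. c i (g i)) * ?t g) \<le> ?B" if g: "g \<in> ?G" for g
  proof (cases "inj_on g {0..<n}")
    case False
    then obtain i j where ij: "i < n" "j < n" "i \<noteq> j" "g i = g j"
      unfolding inj_on_def by auto
    have "?t g = 0"
      by (rule det_identical_rows[of _ n i j]) (use ij in \<open>auto intro!: eq_vecI\<close>)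
    thus ?thesis using w C by (auto intro!: mult_nonneg_nonneg prod_nonneg)
  next
    case True
    have gM: "g i < M" if "i < n" for i using g that by (auto simp: PiE_def Pi_def)
    have card: "card (g ` {0..<n}) = n" using card_image[OF True] by simp
    have "(\<Sum>i<n. i) \<le> (\<Sum>x\<in>g ` {0..<n}. min x n)"
      using sum_min_ge[of "g ` {0..<n}"] card by simp
    also have "\<dots> = (\<Sum>i<n. min (g i) n)"
      by (subst sum.reindex[OF True]) (simp add: atLeast0LessThan)
    finally have le: "(\<Sum>i<n. i) \<le> (\<Sum>i<n. min (g i) n)" .
    have "norm (\<Prod>i = 0..<n. c i (g i)) \<le> (\<Prod>i<n. C i * w ^ min (g i) n)"
      unfolding prod_norm[symmetric] atLeast0LessThan
      by (intro prod_mono) (auto intro!: c gM)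
    also have "\<dots> = (\<Prod>i<n. C i) * w ^ (\<Sum>i<n. min (g i) n)"
      by (simp add: prod.distrib power_sum)
    also have "\<dots> \<le> (\<Prod>i<n. C i) * w ^ (\<Sum>i<n. i)"
      using C w le by (intro mult_left_mono power_decreasing) (auto intro!: prod_nonneg)
    finally show ?thesis unfolding norm_mult
      using w C by (intro mult_mono norm_det_le_fact t gM) (auto intro!: mult_nonneg_nonneg prod_nonneg)
  qed
  hence "norm (\<Sum>g\<in>?G. (\<Prod>i = 0..<n. c i (g i)) * ?t g) \<le> (\<Sum>g\<in>?G. ?B)"
    by (rule sum_norm_le)
  also have "\<dots> = real M ^ n * ?B" by (simp add: card_PiE)
  finally show ?thesis by (subst det_expand_rows[OF F]) auto
qed

text \<open>Coefficients of a Chebyshev expansion at \<open>cos \<theta>\<close>, truncated at the size of the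
  interpolation determinant. The decay rate \<open>\<tau>\<close> is the one given by the Bernstein ellipse.\<close>

definition cheb_bounded ::
  "real \<Rightarrow> nat \<Rightarrow> 'a set \<Rightarrow> ('a \<Rightarrow> real) \<Rightarrow> ('a \<Rightarrow> complex) \<Rightarrow> real \<Rightarrow> bool" where
  "cheb_bounded \<tau> N S \<theta> f C \<longleftrightarrow> (\<exists>c. (\<forall>m<N. norm (c m) \<le> C / \<tau> ^ m) \<and>
     (\<forall>x\<in>S. norm (f x - (\<Sum>m<N. c m * of_real (cos (real m * \<theta> x)))) \<le> C / \<tau> ^ N))"

lemma cheb_bounded_det:
  fixes f :: "nat \<Rightarrow> 'a \<Rightarrow> complex"
  assumes f: "\<And>i. i < N \<Longrightarrow> cheb_bounded \<tau> N S \<theta> (f i) (C i)"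
    and xs: "\<And>j. j < N \<Longrightarrow> xs j \<in> S" and \<tau>: "\<tau> \<ge> 1" and C: "\<And>i. i < N \<Longrightarrow> C i \<ge> 0"
  shows "norm (det (mat N N (\<lambda>(i, j). f i (xs j))))
    \<le> real (2 * N) ^ N * ((\<Prod>i<N. C i) * (1 / \<tau>) ^ (\<Sum>i<N. i) * fact N)"
proof -
  have "\<forall>i. \<exists>c. i < N \<longrightarrow> (\<forall>m<N. norm (c m) \<le> C i / \<tau> ^ m) \<and>
     (\<forall>x\<in>S. norm (f i x - (\<Sum>m<N. c m * of_real (cos (real m * \<theta> x)))) \<le> C i / \<tau> ^ N)"
    using f unfolding cheb_bounded_def by blast
  then obtain c where c1: "\<And>i m. i < N \<Longrightarrow> m < N \<Longrightarrow> norm (c i m) \<le> C i / \<tau> ^ m"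
    and c2: "\<And>i x. i < N \<Longrightarrow> x \<in> S \<Longrightarrow>
      norm (f i x - (\<Sum>m<N. c i m * of_real (cos (real m * \<theta> x)))) \<le> C i / \<tau> ^ N"
    by metis
  define e where "e i j = f i (xs j) - (\<Sum>m<N. c i m * of_real (cos (real m * \<theta> (xs j))))" for i j
  \<comment> \<open>The indices \<open>N + j\<close> carry the truncation errors: the corresponding
    row of \<open>t\<close> is the j-th unit vector, and its coefficient is the error at
    \<open>xs j\<close>. The expansion becomes exact with 2N terms, and the errors fit the decay
    \<open>min m N\<close>.\<close>
  define c' where "c' i m = (if m < N then c i m else e i (m - N))" for i m
  define t where "t m j = (if m < N then of_real (cos (real m * \<theta> (xs j)))
    else if m = N + j then 1 else 0 :: complex)" for m j
  show ?thesis
  proof (rule norm_det_decay[where c = c' and t = t])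
    fix i j assume ij: "i < N" "j < N"
    have "(\<Sum>m<2*N. c' i m * t m j) =
       (\<Sum>m<N. c' i m * t m j) + (\<Sum>m=N..<2*N. c' i m * t m j)"
      using sum.atLeastLessThan_concat[of 0 N "2*N" "\<lambda>m. c' i m * t m j"] by (simp add: atLeast0LessThan)
    also have "(\<Sum>m=N..<2*N. c' i m * t m j) = (\<Sum>m=N..<2*N. if m = N + j then e i j else 0)"
      by (intro sum.cong) (auto simp: c'_def t_def)
    also have "\<dots> = e i j" using ij by simp
    also have "(\<Sum>m<N. c' i m * t m j) = (\<Sum>m<N. c i m * of_real (cos (real m * \<theta> (xs j))))"
      by (intro sum.cong) (auto simp: c'_def t_def)
    finally show "f i (xs j) = (\<Sum>m<2*N. c' i m * t m j)" by (simp add: e_def)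
  next
    fix i m assume "i < N" "m < 2 * N"
    thus "norm (c' i m) \<le> C i * (1 / \<tau>) ^ min m N"
      using c1[of i m] c2[of i "xs (m - N)"] xs[of "m - N"]
      by (auto simp: c'_def e_def power_one_over min_def field_simps)
  qed (use \<tau> C in \<open>auto simp: t_def\<close>)
qed

section \<open>Chebyshev bounds for powers, falling products and exponentials\<close>

lemma cheb_bounded_cos:
  assumes "\<tau> \<ge> 1"
  shows "cheb_bounded \<tau> N S \<theta> (\<lambda>x. of_real (cos (real m * \<theta> x))) (\<tau> ^ m)"
proof (cases "m < N")
  case True
  have "(\<Sum>k<N. (if k = m then 1 else 0) * of_real (cos (real k * \<theta> x))) = complex_of_real (cos (real m * \<theta> x))" for x
    using True by (subst sum.cong[OF refl, of _ _ "\<lambda>k. if k = m then of_real (cos (real m * \<theta> x)) else 0"]) auto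
  thus ?thesis using assms unfolding cheb_bounded_def
    by (intro exI[of _ "\<lambda>k. if k = m then 1 else 0"]) auto
next
  case False
  \<comment> \<open>From the truncation order on, the whole function is counted as error and all
    coefficients are 0.\<close>
  have "\<bar>cos y\<bar> \<le> \<tau> ^ m / \<tau> ^ N" for y
  proof -
    have "\<tau> ^ N \<le> \<tau> ^ m" using False assms by (intro power_increasing) auto
    hence "1 \<le> \<tau> ^ m / \<tau> ^ N" using assms by simp
    thus ?thesis using abs_cos_le_one[of y] by linarith
  qed
  thus ?thesis using assms unfolding cheb_bounded_def
    by (intro exI[of _ "\<lambda>_. 0"]) (auto simp flip: of_real_mult)
qed

lemma cheb_bounded_cmult:
  assumes "cheb_bounded \<tau> N S \<theta> f C"
  shows "cheb_bounded \<tau> N S \<theta> (\<lambda>x. a * f x) (norm a * C)"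
proof -
  obtain c where c: "\<forall>m<N. norm (c m) \<le> C / \<tau> ^ m"
    "\<forall>x\<in>S. norm (f x - (\<Sum>m<N. c m * of_real (cos (real m * \<theta> x)))) \<le> C / \<tau> ^ N"
    using assms unfolding cheb_bounded_def by blast
  have "norm (a * f x - (\<Sum>m<N. (a * c m) * of_real (cos (real m * \<theta> x)))) \<le> norm a * C / \<tau> ^ N"
    if "x \<in> S" for x
  proof -
    have "a * f x - (\<Sum>m<N. (a * c m) * of_real (cos (real m * \<theta> x))) =
       a * (f x - (\<Sum>m<N. c m * of_real (cos (real m * \<theta> x))))"
      by (simp add: right_diff_distrib sum_distrib_left mult_ac)
    thus ?thesis using mult_left_mono[OF bspec[OF c(2) that], of "norm a"] by (simp add: norm_mult)
  qed
  moreover have "norm (a * c m) \<le> norm a * C / \<tau> ^ m" if "m < N" for m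
    using mult_left_mono[OF c(1)[rule_format, OF that], of "norm a"] by (simp add: norm_mult)
  ultimately show ?thesis unfolding cheb_bounded_def by (intro exI[of _ "\<lambda>m. a * c m"]) auto
qed

text \<open>A perturbation of size \<tau>^(-N) is absorbed by the truncation error. Both the tail of
  the exponential series and the effect of \<Lambda> enter in this way.\<close>

lemma cheb_bounded_perturb:
  assumes "cheb_bounded \<tau> N S \<theta> f C" "\<tau> > 0" "D \<ge> 0"
    and "\<And>x. x \<in> S \<Longrightarrow> norm (g x - f x) \<le> D / \<tau> ^ N"
  shows "cheb_bounded \<tau> N S \<theta> g (C + D)"
proof -
  obtain c where c: "\<forall>m<N. norm (c m) \<le> C / \<tau> ^ m"
    "\<forall>x\<in>S. norm (f x - (\<Sum>m<N. c m * of_real (cos (real m * \<theta> x)))) \<le> C / \<tau> ^ N"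
    using assms unfolding cheb_bounded_def by blast
  have "norm (g x - (\<Sum>m<N. c m * of_real (cos (real m * \<theta> x)))) \<le> (C + D) / \<tau> ^ N"
    if "x \<in> S" for x
    using norm_triangle_ineq[of "g x - f x" "f x - (\<Sum>m<N. c m * of_real (cos (real m * \<theta> x)))"]
      assms(4)[OF that] bspec[OF c(2) that] by (simp add: add_divide_distrib)
  moreover have "norm (c m) \<le> (C + D) / \<tau> ^ m" if "m < N" for m
    using c(1) that assms by (meson divide_right_mono le_add_same_cancel1 order_trans zero_le_power less_imp_le)
  ultimately show ?thesis unfolding cheb_bounded_def by blast
qed

lemma cheb_bounded_add:
  assumes "cheb_bounded \<tau> N S \<theta> f C" "cheb_bounded \<tau> N S \<theta> g D"
  shows "cheb_bounded \<tau> N S \<theta> (\<lambda>x. f x + g x) (C + D)"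
proof -
  obtain c where c: "\<forall>m<N. norm (c m) \<le> C / \<tau> ^ m"
    "\<forall>x\<in>S. norm (f x - (\<Sum>m<N. c m * of_real (cos (real m * \<theta> x)))) \<le> C / \<tau> ^ N"
    using assms(1) unfolding cheb_bounded_def by blast
  obtain d where d: "\<forall>m<N. norm (d m) \<le> D / \<tau> ^ m"
    "\<forall>x\<in>S. norm (g x - (\<Sum>m<N. d m * of_real (cos (real m * \<theta> x)))) \<le> D / \<tau> ^ N"
    using assms(2) unfolding cheb_bounded_def by blast
  have "norm (f x + g x - (\<Sum>m<N. (c m + d m) * of_real (cos (real m * \<theta> x)))) \<le> (C + D) / \<tau> ^ N"
    if "x \<in> S" for x
    using norm_triangle_mono[OF bspec[OF c(2) that] bspec[OF d(2) that]]
    by (simp add: algebra_simps sum.distrib add_divide_distrib)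
  moreover have "norm (c m + d m) \<le> (C + D) / \<tau> ^ m" if "m < N" for m
    using norm_triangle_mono[OF c(1)[rule_format, OF that] d(1)[rule_format, OF that]]
    by (simp add: add_divide_distrib)
  ultimately show ?thesis unfolding cheb_bounded_def by (intro exI[of _ "\<lambda>m. c m + d m"]) auto
qed

lemma cheb_bounded_mono:
  assumes "cheb_bounded \<tau> N S \<theta> f C" "C \<le> D" "\<tau> > 0"
  shows "cheb_bounded \<tau> N S \<theta> f D"
  using cheb_bounded_perturb[OF assms(1,3), of "D - C" f] assms by simp

lemma cheb_bounded_sum:
  assumes "finite I" "\<And>i. i \<in> I \<Longrightarrow> cheb_bounded \<tau> N S \<theta> (f i) (C i)"
  shows "cheb_bounded \<tau> N S \<theta> (\<lambda>x. \<Sum>i\<in>I. f i x) (\<Sum>i\<in>I. C i)"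
  using assms
proof (induction I rule: finite_induct)
  case empty
  show ?case unfolding cheb_bounded_def by (intro exI[of _ "\<lambda>_. 0"]) auto
qed (simp add: cheb_bounded_add)

lemma cheb_bounded_cong:
  assumes "cheb_bounded \<tau> N S \<theta> f C" "\<And>x. x \<in> S \<Longrightarrow> f x = g x"
  shows "cheb_bounded \<tau> N S \<theta> g C"
  using assms(1) by (simp add: cheb_bounded_def assms(2))

lemma cos_power_expansion:
  "cos t ^ d = (\<Sum>j\<le>d. real (d choose j) / 2 ^ d * cos (real (nat \<bar>2 * int j - int d\<bar>) * t))"
proof -
  have abs_cos: "cos (real_of_int k * t) = cos (real (nat \<bar>k\<bar>) * t)" for k
    by (cases "k \<ge> 0") auto
  have "complex_of_real (2 * cos t) ^ d = (cis t + cis (- t)) ^ d"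
    by (simp add: complex_eq_iff cis.ctr)
  also have "\<dots> = (\<Sum>j\<le>d. of_nat (d choose j) * cis t ^ j * cis (- t) ^ (d - j))"
    by (rule binomial_ring)
  also have "\<dots> = (\<Sum>j\<le>d. of_nat (d choose j) * cis (real_of_int (2 * int j - int d) * t))"
    by (intro sum.cong refl) (simp add: Complex.DeMoivre cis_mult algebra_simps of_nat_diff)
  finally have "Re (complex_of_real (2 * cos t) ^ d) =
      (\<Sum>j\<le>d. real (d choose j) * cos (real_of_int (2 * int j - int d) * t))"
    by (simp add: Re_sum)
  also have "Re (complex_of_real (2 * cos t) ^ d) = 2 ^ d * cos t ^ d"
    by (simp add: power_mult_distrib flip: of_real_power)
  also have "(\<Sum>j\<le>d. real (d choose j) * cos (real_of_int (2 * int j - int d) * t)) =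
      (\<Sum>j\<le>d. real (d choose j) * cos (real (nat \<bar>2 * int j - int d\<bar>) * t))"
    by (simp only: abs_cos)
  finally have "cos t ^ d = (\<Sum>j\<le>d. real (d choose j) * cos (real (nat \<bar>2 * int j - int d\<bar>) * t)) / 2 ^ d"
    by (simp add: field_simps)
  thus ?thesis by (simp add: sum_divide_distrib)
qed

text \<open>\<open>T * ((\<tau> + 1 / \<tau>) / 2)\<close> is the larger semi-axis of the Bernstein
  ellipse with foci T and -T, hence the maximum of |z| on it. The factor 2 comes from bounding
  \<tau>^|2j-d| by the sum of both signs of the exponent, each of which gives a full binomial
  sum.\<close>

lemma cheb_bounded_power:
  assumes \<tau>: "\<tau> \<ge> 1" and T: "T \<ge> 0"
  shows "cheb_bounded \<tau> N S \<theta> (\<lambda>x. of_real (T * cos (\<theta> x)) ^ d) (2 * (T * ((\<tau> + 1 / \<tau>) / 2)) ^ d)"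
proof -
  define k where "k j = nat \<bar>2 * int j - int d\<bar>" for j
  define a where "a j = complex_of_real (T ^ d * (real (d choose j) / 2 ^ d))" for j
  have "cheb_bounded \<tau> N S \<theta> (\<lambda>x. \<Sum>j\<le>d. a j * of_real (cos (real (k j) * \<theta> x)))
      (\<Sum>j\<le>d. norm (a j) * \<tau> ^ k j)"
    by (intro cheb_bounded_sum cheb_bounded_cmult cheb_bounded_cos \<tau>) auto
  moreover have "(\<Sum>j\<le>d. a j * of_real (cos (real (k j) * t))) = of_real (T * cos t) ^ d" for t
    unfolding of_real_power[symmetric] power_mult_distrib cos_power_expansion a_def k_def
    by (simp add: sum_distrib_left mult_ac)
  moreover have "(\<Sum>j\<le>d. norm (a j) * \<tau> ^ k j) \<le> 2 * (T * ((\<tau> + 1 / \<tau>) / 2)) ^ d"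
  proof -
    have "\<tau> ^ k j \<le> \<tau> ^ j * (1 / \<tau>) ^ (d - j) + (1 / \<tau>) ^ j * \<tau> ^ (d - j)" if "j \<le> d" for j
    proof (cases "d - j \<le> j")
      case True
      hence "k j + (d - j) = j" using that unfolding k_def by linarith
      hence e: "\<tau> ^ k j * \<tau> ^ (d - j) = \<tau> ^ j" by (simp flip: power_add)
      have "\<tau> ^ j * (1 / \<tau>) ^ (d - j) = \<tau> ^ k j"
        unfolding e[symmetric] using \<tau> by (simp add: power_one_over)
      thus ?thesis using \<tau> by simp
    next
      case False
      hence "k j + j = d - j" using that unfolding k_def by linarith
      hence e: "\<tau> ^ k j * \<tau> ^ j = \<tau> ^ (d - j)" by (simp flip: power_add)
      have "(1 / \<tau>) ^ j * \<tau> ^ (d - j) = \<tau> ^ k j"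
        unfolding e[symmetric] using \<tau> by (simp add: power_one_over)
      thus ?thesis using \<tau> by simp
    qed
    hence "(\<Sum>j\<le>d. norm (a j) * \<tau> ^ k j) \<le> (\<Sum>j\<le>d. norm (a j) *
        (\<tau> ^ j * (1 / \<tau>) ^ (d - j) + (1 / \<tau>) ^ j * \<tau> ^ (d - j)))"
      by (intro sum_mono mult_left_mono) auto
    also have "\<dots> = (T / 2) ^ d * ((\<Sum>j\<le>d. real (d choose j) * \<tau> ^ j * (1 / \<tau>) ^ (d - j)) +
        (\<Sum>j\<le>d. real (d choose j) * (1 / \<tau>) ^ j * \<tau> ^ (d - j)))"
      using T unfolding sum.distrib[symmetric] sum_distrib_left
      by (intro sum.cong refl) (simp add: a_def norm_mult norm_divide norm_power field_simps del: of_real_mult)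
    also have "\<dots> = (T / 2) ^ d * ((\<tau> + 1 / \<tau>) ^ d + (1 / \<tau> + \<tau>) ^ d)"
      unfolding binomial_ring[symmetric] by simp
    also have "\<dots> = 2 * (T * ((\<tau> + 1 / \<tau>) / 2)) ^ d"
      by (simp add: power_mult_distrib power_divide add.commute)
    finally show ?thesis .
  qed
  ultimately show ?thesis using cheb_bounded_mono[of \<tau>] \<tau> by simp
qed

text \<open>Multiplication by a linear factor a z - k only shifts the exponent \<open>q\<close> and
  adds a multiple of the old function. Carrying \<open>q\<close> through the induction therefore
  avoids a product rule, which would multiply the constants \<open>C\<close>.\<close>

lemma cheb_bounded_falling_product:
  fixes z :: "'a \<Rightarrow> complex"
  assumes "\<And>q. cheb_bounded \<tau> N S \<theta> (\<lambda>x. z x ^ q) (C * X ^ q)"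
    and "\<tau> > 0" "C \<ge> 0" "X \<ge> 0" "a \<ge> 0"
  shows "cheb_bounded \<tau> N S \<theta> (\<lambda>x. (\<Prod>i<k. of_real a * z x - of_nat i) * z x ^ q)
    (C * (a * X + real k) ^ k * X ^ q)"
proof -
  have "cheb_bounded \<tau> N S \<theta> (\<lambda>x. (\<Prod>i<k. of_real a * z x - of_nat i) * z x ^ q)
    (C * (\<Prod>i<k. a * X + real i) * X ^ q)"
  proof (induction k arbitrary: q)
    case 0
    show ?case using assms(1) by simp
  next
    case (Suc k)
    let ?p = "\<lambda>x. \<Prod>i<k. of_real a * z x - of_nat i" and ?C = "C * (\<Prod>i<k. a * X + real i)"
    have "cheb_bounded \<tau> N S \<theta> (\<lambda>x. of_real a * (?p x * z x ^ Suc q) + (- of_nat k) * (?p x * z x ^ q))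
      (norm (complex_of_real a) * (?C * X ^ Suc q) + norm (- of_nat k :: complex) * (?C * X ^ q))"
      by (intro cheb_bounded_add cheb_bounded_cmult Suc.IH)
    moreover have "norm (complex_of_real a) * (?C * X ^ Suc q) + norm (- of_nat k :: complex) * (?C * X ^ q)
       = C * (\<Prod>i<Suc k. a * X + real i) * X ^ q"
      using assms by (simp add: algebra_simps)
    moreover have "(\<lambda>x. of_real a * (?p x * z x ^ Suc q) + (- of_nat k) * (?p x * z x ^ q)) =
       (\<lambda>x. (\<Prod>i<Suc k. of_real a * z x - of_nat i) * z x ^ q)"
      by (intro ext) (simp add: algebra_simps)
    ultimately show ?case by simp
  qed
  moreover have "(\<Prod>i<k. a * X + real i) \<le> (\<Prod>i<k. a * X + real k)"
    using assms by (intro prod_mono) auto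
  hence "C * (\<Prod>i<k. a * X + real i) * X ^ q \<le> C * (a * X + real k) ^ k * X ^ q"
    using assms by (intro mult_right_mono mult_left_mono) auto
  ultimately show ?thesis using cheb_bounded_mono assms(2) by blast
qed

text \<open>The exponential series is integrated term by term into the bounds for f z^q, up to an
  order \<open>Q\<close> beyond which the tail is below \<open>D / \<tau> ^ N\<close>. Finiteness of
  \<open>S\<close> gives one \<open>Q\<close> for all points. Partial sum and tail each cost
  \<open>D\<close>, whence the factor 2.\<close>

lemma cheb_bounded_mult_cis:
  fixes f :: "'a \<Rightarrow> complex" and z :: "'a \<Rightarrow> real"
  assumes f: "\<And>q. cheb_bounded \<tau> N S \<theta> (\<lambda>x. f x * of_real (z x) ^ q) (C * X ^ q)"
    and S: "finite S" and \<tau>: "\<tau> > 0" and C: "C > 0" and X: "X \<ge> 0"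
  shows "cheb_bounded \<tau> N S \<theta> (\<lambda>x. f x * cis (l * z x)) (2 * C * exp (\<bar>l\<bar> * X))"
proof -
  define h where "h Q x = (\<Sum>q<Q. (\<i> * of_real l) ^ q / fact q * (f x * of_real (z x) ^ q))" for Q x
  define D where "D = C * exp (\<bar>l\<bar> * X)"
  have D: "D > 0" using C by (simp add: D_def)
  have lim: "(\<lambda>Q. h Q x) \<longlonglongrightarrow> f x * cis (l * z x)" for x
  proof -
    have "(\<lambda>q. f x * ((\<i> * of_real (l * z x)) ^ q /\<^sub>R fact q)) sums (f x * exp (\<i> * of_real (l * z x)))"
      by (intro sums_mult exp_converges)
    thus ?thesis
      by (simp add: sums_def h_def cis_conv_exp power_mult_distrib scaleR_conv_of_real field_simps)
  qed
  have "\<forall>\<^sub>F Q in sequentially. \<forall>x\<in>S. dist (h Q x) (f x * cis (l * z x)) < D / \<tau> ^ N"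
    using D \<tau> by (intro eventually_ball_finite S ballI tendstoD lim) auto
  then obtain Q where Q: "\<And>x. x \<in> S \<Longrightarrow> norm (f x * cis (l * z x) - h Q x) \<le> D / \<tau> ^ N"
    by (auto simp: eventually_sequentially dist_norm norm_minus_commute intro: less_imp_le)
  have "cheb_bounded \<tau> N S \<theta> (h Q) (\<Sum>q<Q. norm ((\<i> * of_real l) ^ q / fact q :: complex) * (C * X ^ q))"
    unfolding h_def by (intro cheb_bounded_sum cheb_bounded_cmult f) auto
  moreover have "(\<Sum>q<Q. norm ((\<i> * of_real l) ^ q / fact q :: complex) * (C * X ^ q)) \<le> D"
  proof -
    have "(\<Sum>q<Q. (\<bar>l\<bar> * X) ^ q /\<^sub>R fact q) \<le> (\<Sum>q. (\<bar>l\<bar> * X) ^ q /\<^sub>R fact q)"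
      using X by (intro sum_le_suminf summable_exp_generic) auto
    also have "\<dots> = exp (\<bar>l\<bar> * X)" by (simp add: exp_def)
    finally have "C * (\<Sum>q<Q. (\<bar>l\<bar> * X) ^ q /\<^sub>R fact q) \<le> D"
      unfolding D_def using C by simp
    thus ?thesis
      by (simp add: norm_mult norm_divide norm_power power_mult_distrib sum_distrib_left field_simps)
  qed
  ultimately have "cheb_bounded \<tau> N S \<theta> (h Q) D" using \<tau> by (rule cheb_bounded_mono)
  hence "cheb_bounded \<tau> N S \<theta> (\<lambda>x. f x * cis (l * z x)) (D + D)"
    by (rule cheb_bounded_perturb) (use \<tau> D Q in auto)
  thus ?thesis by (simp add: D_def mult.assoc)
qed

section \<open>Arithmetic lower bound\<close>

definition int_lattice :: "complex \<Rightarrow> complex set" where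
  "int_lattice \<alpha> = {of_int x + of_int y * \<alpha> | x y. True}"

lemma int_latticeI: "z = of_int x + of_int y * \<alpha> \<Longrightarrow> z \<in> int_lattice \<alpha>"
  by (auto simp: int_lattice_def)

lemma int_lattice_of_int [simp]: "of_int x \<in> int_lattice \<alpha>"
  by (rule int_latticeI[of _ x 0]) simp

lemma int_lattice_self [simp]: "\<alpha> \<in> int_lattice \<alpha>"
  by (rule int_latticeI[of _ 0 1]) simp

lemma int_lattice_add: "z \<in> int_lattice \<alpha> \<Longrightarrow> w \<in> int_lattice \<alpha> \<Longrightarrow> z + w \<in> int_lattice \<alpha>"
proof -
  assume "z \<in> int_lattice \<alpha>" "w \<in> int_lattice \<alpha>"
  then obtain x y x' y' where "z = of_int x + of_int y * \<alpha>" "w = of_int x' + of_int y' * \<alpha>"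
    by (auto simp: int_lattice_def)
  thus ?thesis by (intro int_latticeI[of _ "x + x'" "y + y'"]) (simp add: algebra_simps)
qed

context
  fixes A B :: int and \<alpha> :: complex
  assumes tr: "\<alpha> + cnj \<alpha> = of_int A" and nm: "\<alpha> * cnj \<alpha> = of_int B"
begin

lemma int_lattice_mult:
  assumes "z \<in> int_lattice \<alpha>" "w \<in> int_lattice \<alpha>"
  shows "z * w \<in> int_lattice \<alpha>"
proof -
  obtain x y x' y' where *: "z = of_int x + of_int y * \<alpha>" "w = of_int x' + of_int y' * \<alpha>"
    using assms by (auto simp: int_lattice_def)
  have "\<alpha> * \<alpha> = of_int A * \<alpha> - of_int B"
    unfolding tr[symmetric] nm[symmetric] by (simp add: algebra_simps)
  moreover have "z * w = of_int (x * x') + of_int (x * y' + y * x') * \<alpha> + of_int (y * y') * (\<alpha> * \<alpha>)"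
    unfolding * by (simp add: algebra_simps)
  ultimately have "z * w = of_int (x * x') + of_int (x * y' + y * x') * \<alpha>
      + of_int (y * y') * (of_int A * \<alpha> - of_int B)" by simp
  hence "z * w = of_int (x * x' - y * y' * B) + of_int (x * y' + y * x' + y * y' * A) * \<alpha>"
    by (simp add: algebra_simps)
  thus ?thesis by (rule int_latticeI)
qed

lemma int_lattice_power: "z \<in> int_lattice \<alpha> \<Longrightarrow> z ^ n \<in> int_lattice \<alpha>"
  using int_lattice_of_int[of 1 \<alpha>] by (induction n) (auto intro: int_lattice_mult)

lemma int_lattice_cnj: "cnj \<alpha> \<in> int_lattice \<alpha>"
  by (rule int_latticeI[of _ A "-1"]) (simp flip: tr)

lemma int_lattice_det:
  assumes "\<And>i j. i < n \<Longrightarrow> j < n \<Longrightarrow> F i j \<in> int_lattice \<alpha>"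
  shows "det (mat n n (\<lambda>(i, j). F i j)) \<in> int_lattice \<alpha>"
proof -
  have sum: "(\<Sum>i\<in>I. f i) \<in> int_lattice \<alpha>" if "\<And>i. i \<in> I \<Longrightarrow> f i \<in> int_lattice \<alpha>"
    for I :: "(nat \<Rightarrow> nat) set" and f
    using that int_lattice_of_int[of 0 \<alpha>]
    by (induction I rule: infinite_finite_induct) (auto intro: int_lattice_add)
  have prod: "(\<Prod>i\<in>I. f i) \<in> int_lattice \<alpha>" if "\<And>i. i \<in> I \<Longrightarrow> f i \<in> int_lattice \<alpha>"
    for I :: "nat set" and f
    using that int_lattice_of_int[of 1 \<alpha>]
    by (induction I rule: infinite_finite_induct) (auto intro: int_lattice_mult)
  have "signof p * (\<Prod>i = 0..<n. mat n n (\<lambda>(i, j). F i j) $$ (i, p i)) \<in> int_lattice \<alpha>"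
    if p: "p permutes {0..<n}" for p
  proof (intro int_lattice_mult prod)
    fix i assume "i \<in> {0..<n}"
    moreover from this have "p i < n" using permutes_in_image[OF p, of i] by simp
    ultimately show "mat n n (\<lambda>(i, j). F i j) $$ (i, p i) \<in> int_lattice \<alpha>"
      using assms by simp
  qed simp
  thus ?thesis unfolding det_def by (auto intro!: sum)
qed

text \<open>As the conjugate of \<alpha> is its complex conjugate, |z|^2 is the norm form of z, an
  integer. No other conjugates have to be estimated.\<close>

lemma int_lattice_norm_ge_1:
  assumes "z \<in> int_lattice \<alpha>" "z \<noteq> 0"
  shows "norm z \<ge> 1"
proof -
  obtain x y where z: "z = of_int x + of_int y * \<alpha>" using assms by (auto simp: int_lattice_def)
  have "complex_of_real ((norm z)\<^sup>2) = z * cnj z" by (rule complex_norm_square)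
  also have "\<dots> = of_int (x * x) + of_int (x * y) * (\<alpha> + cnj \<alpha>) + of_int (y * y) * (\<alpha> * cnj \<alpha>)"
    unfolding z by (simp add: algebra_simps)
  also have "\<dots> = complex_of_real (of_int (x * x + x * y * A + y * y * B))"
    by (simp add: tr nm)
  finally have eq: "(norm z)\<^sup>2 = of_int (x * x + x * y * A + y * y * B)"
    by (simp only: of_real_eq_iff)
  moreover have "(norm z)\<^sup>2 > 0" using assms by simp
  ultimately have "x * x + x * y * A + y * y * B \<ge> 1" by linarith
  hence "(norm z)\<^sup>2 \<ge> 1" unfolding eq by linarith
  thus ?thesis using power2_le_imp_le[of 1 "norm z"] by simp
qed

end

section \<open>Zero estimate\<close>

text \<open>A kernel vector of the transpose is the coefficient list of a nonzero polynomial of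
  degree below m that vanishes at the m distinct values \<open>u i\<close>.\<close>

lemma generalized_vandermonde_nonzero:
  fixes u c :: "nat \<Rightarrow> 'a::field"
  assumes inj: "inj_on u {..<m}" and c: "\<And>i. i < m \<Longrightarrow> c i \<noteq> 0"
  shows "det (mat m m (\<lambda>(j, i). u i ^ j * c i)) \<noteq> 0"
proof
  let ?V = "mat m m (\<lambda>(j, i). u i ^ j * c i)"
  assume "det ?V = 0"
  hence "det (transpose_mat ?V) = 0" by (subst det_transpose) auto
  then obtain v where v: "v \<in> carrier_vec m" "v \<noteq> 0\<^sub>v m" "transpose_mat ?V *\<^sub>v v = 0\<^sub>v m"
    using det_0_iff_vec_prod_zero[of "transpose_mat ?V" m] by auto
  define p where "p = (\<Sum>j<m. monom (v $ j) j)"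
  have coeff: "coeff p j = v $ j" if "j < m" for j
    using that by (simp add: p_def coeff_sum)
  have "poly p (u i) = 0" if i: "i < m" for i
  proof -
    have "0 = (transpose_mat ?V *\<^sub>v v) $ i" using v(3) i by simp
    also have "\<dots> = (\<Sum>j<m. u i ^ j * c i * v $ j)"
      using i v(1) by (auto simp: scalar_prod_def atLeast0LessThan intro!: sum.cong)
    also have "\<dots> = c i * poly p (u i)"
      by (simp add: p_def poly_sum poly_monom sum_distrib_left mult_ac)
    finally show ?thesis using c[OF i] by simp
  qed
  hence sub: "u ` {..<m} \<subseteq> {x. poly p x = 0}" by auto
  obtain j where j: "j < m" "v $ j \<noteq> 0" using v(1,2) by (metis carrier_vecD eq_vecI index_zero_vec(1,2))
  hence p0: "p \<noteq> 0" using coeff by fastforce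
  have "m \<le> card {x. poly p x = 0}"
    using card_mono[OF poly_roots_finite[OF p0] sub] card_image[OF inj] by simp
  also have "\<dots> \<le> degree p" by (rule card_poly_roots_bound[OF p0])
  also have "degree p \<le> m - 1"
    unfolding p_def by (intro degree_sum_le) (auto intro: order_trans[OF degree_monom_le])
  finally show False using j by simp
qed

lemma coeff_signof_mult: "coeff (signof p * q) n = signof p * coeff q n"
  by (simp add: sign_def)

text \<open>The translates of \<open>F(X, Y) = \<Sum> P\<^sub>l(X) Y\<^sup>l\<close> by \<open>(j k, \<gamma>\<^sup>j)\<close> form a square linear system
  in the monomials \<open>Y\<^sup>l\<close>; its determinant is a nonzero polynomial in \<open>X\<close>, because its leading
  coefficient is a Vandermonde determinant, and it vanishes wherever all the translates do.\<close>

lemma zero_estimate: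
  fixes P :: "nat \<Rightarrow> complex poly" and \<gamma> k :: complex and \<eta> :: "complex \<Rightarrow> complex"
  assumes inj: "inj_on (\<lambda>l. \<gamma> ^ l) {..<L}"
    and deg: "\<And>l. l < L \<Longrightarrow> degree (P l) < K" and nz: "\<exists>l<L. P l \<noteq> 0"
    and fin: "finite E" and \<eta>: "\<And>x. x \<in> E \<Longrightarrow> \<eta> x \<noteq> 0" and \<gamma>: "\<gamma> \<noteq> 0"
    and van: "\<And>x j. x \<in> E \<Longrightarrow> j < L \<Longrightarrow>
      (\<Sum>l<L. poly (P l) (x + of_nat j * k) * (\<gamma> ^ j * \<eta> x) ^ l) = 0"
  shows "card E \<le> (K - 1) * L"
proof -
  \<comment> \<open>Only the indices with nonzero P_l are kept, so that every leading coefficient is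
    nonzero; then m \<le> L translates suffice for a square system.\<close>
  define M where "M = {l. l < L \<and> P l \<noteq> 0}"
  define m where "m = card M"
  have finM: "finite M" by (simp add: M_def)
  have "M \<subseteq> {..<L}" by (auto simp: M_def)
  hence mL: "m \<le> L" using card_mono[of "{..<L}" M] by (simp add: m_def)
  have m0: "m > 0" using nz finM by (auto simp: m_def card_gt_0_iff M_def)
  obtain e where e: "bij_betw e {0..<m} M" using ex_bij_betw_nat_finite[OF finM] m_def by auto
  have eM: "e i < L" "P (e i) \<noteq> 0" if "i < m" for i
    using bij_betwE[OF e] that by (auto simp: M_def)
  have einj: "inj_on e {..<m}" using e by (simp add: bij_betw_def atLeast0LessThan)
  define q where "q j i = smult ((\<gamma> ^ e i) ^ j) (pcompose (P (e i)) [:of_nat j * k, 1:])" for j i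
  have q0: "q j i \<noteq> 0" and degq: "degree (q j i) = degree (P (e i))"
    and lcq: "lead_coeff (q j i) = (\<gamma> ^ e i) ^ j * lead_coeff (P (e i))" if "i < m" for j i
    using eM[OF that] \<gamma> lead_coeff_comp[of "[:of_nat j * k, 1:]" "P (e i)"]
    by (auto simp: q_def pcompose_eq_0_iff degree_pcompose)
  define D where "D = det (mat m m (\<lambda>(j, i). q j i))"
  note * = prod_index_mat_permutes
  \<comment> \<open>Translation preserves degrees, so each permutation contributes a product of
    degree exactly \<open>s\<close>. The coefficient of \<open>D\<close> at \<open>s\<close> is thus
    the signed sum of all leading coefficients, which is again a determinant.\<close>
  define s where "s = (\<Sum>i = 0..<m. degree (P (e i)))"
  have "coeff D s = (\<Sum>p | p permutes {0..<m}. signof p * coeff (\<Prod>j = 0..<m. q j (p j)) s)"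
    unfolding D_def det_def by (simp add: coeff_sum coeff_signof_mult *)
  also have "\<dots> = (\<Sum>p | p permutes {0..<m}. signof p *
      (\<Prod>j = 0..<m. (\<gamma> ^ e (p j)) ^ j * lead_coeff (P (e (p j)))))"
  proof (intro sum.cong refl arg_cong2[of _ _ _ _ "(*)"])
    fix p assume "p \<in> {p. p permutes {0..<m}}"
    hence p: "p permutes {0..<m}" by simp
    have pm: "p j < m" if "j < m" for j using permutes_in_image[OF p, of j] that by simp
    have "degree (\<Prod>j = 0..<m. q j (p j)) = (\<Sum>j = 0..<m. degree (q j (p j)))"
      by (intro degree_prod_eq_sum_degree) (auto simp: q0 pm)
    also have "\<dots> = (\<Sum>j = 0..<m. degree (P (e (p j))))" by (simp add: degq pm)
    also have "\<dots> = s" unfolding s_def by (rule sum.permute[OF p, unfolded comp_def, symmetric])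
    finally have "coeff (\<Prod>j = 0..<m. q j (p j)) s = lead_coeff (\<Prod>j = 0..<m. q j (p j))" by simp
    also have "\<dots> = (\<Prod>j = 0..<m. lead_coeff (q j (p j)))" by (rule lead_coeff_prod)
    also have "\<dots> = (\<Prod>j = 0..<m. (\<gamma> ^ e (p j)) ^ j * lead_coeff (P (e (p j))))"
      by (intro prod.cong refl lcq pm) auto
    finally show "coeff (\<Prod>j = 0..<m. q j (p j)) s = \<dots>" .
  qed
  also have "\<dots> = det (mat m m (\<lambda>(j, i). (\<gamma> ^ e i) ^ j * lead_coeff (P (e i))))"
    unfolding det_def by (simp add: *)
  also have "\<dots> \<noteq> 0"
  proof (rule generalized_vandermonde_nonzero)
    show "inj_on (\<lambda>i. \<gamma> ^ e i) {..<m}"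
      using inj einj eM by (auto simp: inj_on_def)
  qed (use eM in auto)
  finally have D0: "D \<noteq> 0" by auto
  have "poly D x = 0" if x: "x \<in> E" for x
  proof -
    let ?Q = "mat m m (\<lambda>(j, i). poly (q j i) x)"
    interpret ev: comm_ring_hom "\<lambda>p. poly p x" by unfold_locales auto
    have "poly D x = det (map_mat (\<lambda>p. poly p x) (mat m m (\<lambda>(j, i). q j i)))"
      unfolding D_def by (rule ev.hom_det[symmetric])
    also have "map_mat (\<lambda>p. poly p x) (mat m m (\<lambda>(j, i). q j i)) = ?Q"
      by (rule eq_matI) auto
    finally have eq: "poly D x = det ?Q" .
    \<comment> \<open>The monomials Y^l at Y = \<eta>(x) form a nonzero kernel vector of the
      evaluated matrix.\<close>
    define w where "w = vec m (\<lambda>i. \<eta> x ^ e i)"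
    have "w \<noteq> 0\<^sub>v m"
    proof
      assume "w = 0\<^sub>v m"
      hence "w $ 0 = 0" using m0 by simp
      thus False using m0 \<eta>[OF x] by (simp add: w_def)
    qed
    moreover have "?Q *\<^sub>v w = 0\<^sub>v m"
    proof (rule eq_vecI)
      fix j assume "j < dim_vec (0\<^sub>v m :: complex vec)"
      hence j: "j < m" by simp
      have "(?Q *\<^sub>v w) $ j = (\<Sum>i = 0..<m. poly (q j i) x * \<eta> x ^ e i)"
        using j by (auto simp: scalar_prod_def w_def intro!: sum.cong)
      also have "\<dots> = (\<Sum>i = 0..<m. poly (P (e i)) (x + of_nat j * k) * (\<gamma> ^ j * \<eta> x) ^ e i)"
        by (intro sum.cong refl)
          (simp add: q_def poly_pcompose power_mult_distrib mult_ac add_ac flip: power_mult)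
      also have "\<dots> = (\<Sum>l\<in>M. poly (P l) (x + of_nat j * k) * (\<gamma> ^ j * \<eta> x) ^ l)"
        by (rule sum.reindex_bij_betw[OF e])
      also have "\<dots> = (\<Sum>l<L. poly (P l) (x + of_nat j * k) * (\<gamma> ^ j * \<eta> x) ^ l)"
        by (rule sum.mono_neutral_left) (auto simp: M_def)
      also have "\<dots> = 0" using van[OF x] j mL by simp
      finally show "(?Q *\<^sub>v w) $ j = 0\<^sub>v m $ j" using j by simp
    qed simp
    moreover have "w \<in> carrier_vec m" by (simp add: w_def)
    ultimately have "det ?Q = 0" using det_0_iff_vec_prod_zero[of ?Q m] by auto
    thus ?thesis using eq by simp
  qed
  hence "card E \<le> card {x. poly D x = 0}"
    by (intro card_mono poly_roots_finite D0) auto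
  also have "\<dots> \<le> degree D" by (rule card_poly_roots_bound[OF D0])
  also have "degree D \<le> (K - 1) * m"
    unfolding D_def
  proof (rule degree_det_le)
    fix i j assume "i < m" "j < m"
    thus "degree (mat m m (\<lambda>(j, i). q j i) $$ (i, j)) \<le> K - 1"
      using degq[of j i] deg[OF eM(1), of j] by simp
  qed simp
  also have "\<dots> \<le> (K - 1) * L" using mL by simp
  finally show ?thesis .
qed

section \<open>Numerical estimates\<close>

lemma norm_cis_diff_le: "norm (cis a - cis b) \<le> \<bar>a - b\<bar>"
proof -
  have "cis b * exp (\<i> * of_real (a - b)) = cis a"
    unfolding cis_conv_exp[symmetric] by (simp add: cis_mult)
  hence "cis a - cis b = cis b * (exp (\<i> * of_real (a - b)) - 1)"
    by (simp only: right_diff_distrib) simp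
  hence "norm (cis a - cis b) = 2 * \<bar>sin ((a - b) / 2)\<bar>"
    by (simp add: norm_mult dist_exp_i_1 del: of_real_diff)
  also have "\<dots> \<le> 2 * \<bar>(a - b) / 2\<bar>" by (intro mult_left_mono abs_sin_x_le_abs_x) auto
  finally show ?thesis by simp
qed

lemma sum_div_mod:
  fixes f :: "nat \<Rightarrow> nat \<Rightarrow> 'a::comm_monoid_add"
  assumes "L > 0"
  shows "(\<Sum>i<K * L. f (i div L) (i mod L)) = (\<Sum>\<kappa><K. \<Sum>m<L. f \<kappa> m)"
proof -
  have block: "(\<Sum>m<L. f \<kappa> m) = (\<Sum>i\<in>{\<kappa> * L..<\<kappa> * L + L}. f (i div L) (i mod L))" for \<kappa>
    by (rule sum.reindex_bij_witness[of _ "\<lambda>i. i - \<kappa> * L" "\<lambda>m. \<kappa> * L + m"]) (use assms in auto)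
  show ?thesis unfolding block by (rule sum.nat_group[symmetric])
qed

lemma sum_abs_centered: "(\<Sum>m<2 * p + 1. \<bar>int m - int p\<bar>) = int p * (int p + 1)"
proof (induction p)
  case (Suc p)
  have "(\<Sum>m<2 * Suc p + 1. \<bar>int m - int (Suc p)\<bar>) =
      (\<Sum>m<Suc (2 * p + 1). \<bar>int m - int (Suc p)\<bar>) + (int p + 1)"
    by (simp add: numeral_2_eq_2)
  also have "(\<Sum>m<Suc (2 * p + 1). \<bar>int m - int (Suc p)\<bar>) = (int p + 1) + (\<Sum>m<2 * p + 1. \<bar>int m - int p\<bar>)"
    by (subst sum.lessThan_Suc_shift) simp
  finally show ?case using Suc by (simp add: algebra_simps)
qed simp

text \<open>t^k / k! is one term of the series of e^t. A single \<open>t\<close> can serve all k in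
  a range, which keeps the base \<open>y / t\<close> the same for all rows of the
  determinant.\<close>

lemma power_div_fact_le:
  fixes y t :: real
  assumes "y \<ge> 0" "t > 0"
  shows "y ^ k / fact k \<le> (y / t) ^ k * exp t"
proof -
  have "t ^ k / fact k \<le> exp t"
    using assms sum_le_suminf[OF summable_exp_generic[of t], of "{k}"]
    by (simp add: exp_def field_simps)
  hence "(y / t) ^ k * (t ^ k / fact k) \<le> (y / t) ^ k * exp t"
    using assms by (intro mult_left_mono) auto
  thus ?thesis using assms by (simp add: power_divide)
qed

lemma sum_smult_degree_eq_0:
  fixes q :: "nat \<Rightarrow> 'a::idom poly"
  assumes "\<And>i. i < K \<Longrightarrow> degree (q i) = i" "\<And>i. i < K \<Longrightarrow> q i \<noteq> 0"
    and "(\<Sum>i<K. smult (a i) (q i)) = 0" "i < K"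
  shows "a i = 0"
  using assms
proof (induction K)
  case (Suc K)
  have "0 = coeff (\<Sum>i<Suc K. smult (a i) (q i)) K" using Suc.prems(3) by simp
  also have "\<dots> = (\<Sum>i<K. a i * coeff (q i) K) + a K * coeff (q K) K" by (simp add: coeff_sum)
  also have "(\<Sum>i<K. a i * coeff (q i) K) = 0"
    using Suc.prems(1) by (intro sum.neutral) (auto intro!: coeff_eq_0)
  finally have "a K * lead_coeff (q K) = 0" using Suc.prems(1) by simp
  hence aK: "a K = 0" using Suc.prems(2)[of K] by simp
  show ?case
  proof (cases "i = K")
    case False
    thus ?thesis using Suc.IH Suc.prems aK by (auto simp: less_Suc_eq)
  qed (use aK in simp)
qed simp

definition gchoose_poly :: "nat \<Rightarrow> complex poly" where
  "gchoose_poly k = smult (1 / fact k) (\<Prod>i<k. [:- of_nat i, 1:])"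

lemma poly_gchoose_poly: "poly (gchoose_poly k) x = x gchoose k"
  by (simp add: gchoose_poly_def gbinomial_prod_rev poly_prod atLeast0LessThan)

lemma degree_gchoose_poly: "degree (gchoose_poly k) = k"
  by (simp add: gchoose_poly_def degree_prod_eq_sum_degree)

lemma gchoose_poly_nonzero: "gchoose_poly k \<noteq> 0"
  by (simp add: gchoose_poly_def)

lemma pi_le: "pi \<le> 3.2"
proof -
  have "arctan (1 / 5) \<le> 1 / 5" "0 \<le> arctan (1 / 239)" using arctan_le_self[of "1 / 5"] by auto
  thus ?thesis unfolding pi_machin by linarith
qed

lemma exp_1_bounds: "exp 1 \<le> (2.72 :: real)" "exp 1 \<ge> (2.7 :: real)"
proof -
  have "exp 1 \<ge> 5837465777 / 2147483648 - inverse (2 ^ 32 :: real)"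
    using e_approx_32 by linarith
  thus "exp 1 \<le> (2.72 :: real)" "exp 1 \<ge> (2.7 :: real)"
    using e_less_272 by simp_all
qed

lemma exp_numeral_bounds: "exp (numeral m) \<le> (2.72 :: real) ^ numeral m" "(2.7 :: real) ^ numeral m \<le> exp (numeral m)"
proof -
  have "exp (numeral m) = (exp 1 :: real) ^ numeral m" by (simp flip: exp_of_nat_mult)
  thus "exp (numeral m) \<le> (2.72 :: real) ^ numeral m" "(2.7 :: real) ^ numeral m \<le> exp (numeral m)"
    using exp_1_bounds by (auto intro!: power_mono)
qed

lemma cosh_2_le: "(exp 2 + 1 / exp 2) / 2 \<le> (3.77 :: real)"
proof -
  have "exp 2 \<le> (2.72\<^sup>2 :: real)" "exp 2 \<ge> (2.7\<^sup>2 :: real)" by (rule exp_numeral_bounds)+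
  moreover from this have "1 / exp 2 \<le> 1 / (2.7\<^sup>2 :: real)" by (intro divide_left_mono) auto
  ultimately show ?thesis by (simp add: power2_eq_square)
qed

lemma ln_16_square_less:
  fixes N :: real
  assumes "N \<ge> 36000"
  shows "ln (16 * N\<^sup>2) < 0.04 * N"
proof -
  define s where "s = sqrt N"
  have s: "s\<^sup>2 = N" using assms by (simp add: s_def)
  have "sqrt (180\<^sup>2) \<le> s" unfolding s_def using assms by (intro real_sqrt_le_mono) simp
  hence s180: "s \<ge> 180" by simp
  \<comment> \<open>\<open>ln x \<le> x - 1\<close> is too weak at 16 N^2 itself; after the fourth
    root and the division by 10 it grows only like sqrt N.\<close>
  have "16 * N\<^sup>2 = (20 * (s / 10)) ^ 4"
    unfolding s[symmetric] by (simp add: power_mult_distrib power_divide)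
  hence "ln (16 * N\<^sup>2) = 4 * ln (20 * (s / 10))"
    using s180 ln_realpow[of "20 * (s / 10)" 4] by (simp only:)
  hence "ln (16 * N\<^sup>2) = 4 * (ln 20 + ln (s / 10))"
    using s180 ln_mult_pos[of 20 "s / 10"] by simp
  moreover have "ln (s / 10) \<le> s / 10 - 1" "ln 20 \<le> (20 :: real) - 1"
    using s180 by (intro ln_le_minus_one; simp)+
  ultimately have "ln (16 * N\<^sup>2) \<le> 0.4 * s + 72" by simp
  also have "\<dots> < 0.04 * (180 * s)" using s180 by simp
  also have "\<dots> \<le> 0.04 * (s * s)" using s180 by (intro mult_left_mono mult_right_mono) auto
  finally show ?thesis using s by (simp add: power2_eq_square)
qed

text \<open>The two binomial terms add up to exactly N (N/2 - p). Exponentials and scaling take at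
  most 0.46 N^2 and the logarithms less than 0.04 N^2. The quadratic shares sum to exactly N^2, and
  the remaining -pN is at most the -N on the right.\<close>

lemma parameters_suffice:
  fixes p c :: nat and X :: real
  assumes "p \<ge> 10" "c \<ge> 7" and K: "K = real (25 * c * p)" and N: "N = K * real (2 * p + 1)"
    and X: "X \<le> 12.07 * real ((8 + 2 * c) * p)"
  shows "N * ln (16 * N\<^sup>2) + real p * (N * (K - 1)) + N * (K / 2)
      + (X + real c * real (8 * p)) * (K * real (p * (p + 1))) < N * (N - 1)"
proof -
  define u where "u = real c * real p"
  define P where "P = real p"
  have p: "P \<ge> 10" using assms by (simp add: P_def)
  have c: "real c \<ge> 7" using assms by simp
  have "7 * P \<le> u" unfolding u_def P_def using c by (intro mult_right_mono) auto
  hence u: "P \<le> u / 7" "u \<ge> 70" using p by auto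
  have K': "K = 25 * u" and N': "N = K * (2 * P + 1)" by (simp_all add: K N u_def P_def)
  have Kpos: "K > 0" using u K' by simp
  have "K * (2 * 10 + 1) \<le> N" unfolding N' using Kpos p by (intro mult_left_mono) auto
  hence N36: "N \<ge> 36000" using K' u by simp
  \<comment> \<open>12.07 * 8 = 96.56 and 12.07 * 2 + 8 = 32.14. With P \<le> u/7 the total stays
    below 46 u = 1.84 K.\<close>
  have "X + real c * real (8 * p) \<le> 96.56 * P + 32.14 * u"
    using X by (simp add: u_def P_def algebra_simps)
  also have "\<dots> \<le> 1.84 * K" using u K' by simp
  finally have "(X + real c * real (8 * p)) * (K * real (p * (p + 1))) \<le> 1.84 * K * (K * (P * (P + 1)))"
    using Kpos by (intro mult_mono) (auto simp: P_def algebra_simps)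
  also have "\<dots> \<le> 1.84 * K * (K * ((2 * P + 1)\<^sup>2 / 4))"
    using Kpos by (intro mult_left_mono) (auto simp: power2_eq_square algebra_simps)
  also have "\<dots> = 0.46 * (N * N)" by (simp add: N' power2_eq_square)
  finally have 1: "(X + real c * real (8 * p)) * (K * real (p * (p + 1))) \<le> 0.46 * (N * N)" .
  have 2: "real p * (N * (K - 1)) + N * (K / 2) = N * (N / 2 - P)"
    by (simp add: N' P_def algebra_simps)
  have "N * ln (16 * N\<^sup>2) < N * (0.04 * N)"
    using ln_16_square_less[OF N36] N36 by (intro mult_strict_left_mono) auto
  moreover have "N * (P - 1) \<ge> 0" using N36 p by simp
  ultimately show ?thesis using 1 2 by (simp add: algebra_simps)
qed

section \<open>The linear form in two logarithms\<close>

text \<open>\<open>\<Lambda> = n \<phi> - k \<pi>\<close> is the linear form in two logarithms. The rows of the interpolation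
  determinant are indexed by \<open>(\<kappa>, l)\<close> with \<open>\<kappa> < K\<close> and \<open>\<bar>l\<bar> \<le> p\<close>, the columns are chosen among the
  \<open>(r, s)\<close> with \<open>\<bar>r\<bar> \<le> 8p\<close> and \<open>\<bar>s\<bar> \<le> 2cp\<close>. Scaling by a power of \<open>B\<close> makes the entries integral.\<close>

locale small_linear_form =
  fixes A B :: int and \<alpha> :: complex and \<phi> :: real and k :: int and n p c :: nat
  assumes trace: "\<alpha> + cnj \<alpha> = of_int A" and norm: "\<alpha> * cnj \<alpha> = of_int B"
    and quot: "\<alpha> / cnj \<alpha> = cis \<phi>" and not_unity: "\<And>m. m \<ge> 1 \<Longrightarrow> cis \<phi> ^ m \<noteq> 1"
    and B_pos: "B > 0" and B_le: "of_int B \<le> exp (real c)"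
    and p_ge: "p \<ge> 10" and c_ge: "c \<ge> 7" and n_ge: "n \<ge> 1" and n_le: "real n \<le> exp (2 * real p)"
    and k_le: "\<bar>k\<bar> \<le> int n"
    and small: "\<bar>real n * \<phi> - of_int k * pi\<bar> \<le> exp (- real (50 * c * p * (2 * p + 1) + p))"
begin

abbreviation (input) "K \<equiv> 25 * c * p"
abbreviation (input) "L \<equiv> 2 * p + 1"
abbreviation (input) "N \<equiv> K * L"
abbreviation (input) "\<Lambda> \<equiv> real n * \<phi> - of_int k * pi"

definition points :: "(int \<times> int) set" where
  "points = {- int (8 * p)..int (8 * p)} \<times> {- int (2 * c * p)..int (2 * c * p)}"

definition node :: "int \<times> int \<Rightarrow> int" where
  "node x = fst x * k + snd x * int n"

definition angle :: "int \<times> int \<Rightarrow> real" where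
  "angle x = of_int (fst x) * \<phi> + of_int (snd x) * pi"

definition freq :: "nat \<Rightarrow> int" where
  "freq i = int (i mod L) - int p"

definition scale :: "nat \<Rightarrow> real" where
  "scale i = of_int B ^ (nat \<bar>freq i\<bar> * (8 * p))"

definition entry :: "nat \<Rightarrow> int \<times> int \<Rightarrow> complex" where
  "entry i x = (of_int (node x) gchoose (i div L)) * of_real (scale i) * cis (of_int (freq i) * angle x)"

section \<open>Integrality of the entries and separation of the nodes\<close>

lemma alpha_nonzero: "\<alpha> \<noteq> 0"
  using norm B_pos by auto

lemma freq_le: "\<bar>freq i\<bar> \<le> int p"
proof -
  have "i mod L < L" by simp
  thus ?thesis unfolding freq_def by linarith
qed

text \<open>Since B = \<alpha> \<open>cnj \<alpha>\<close>, the factor B^M turns (\<alpha> /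
  \<open>cnj \<alpha>\<close>)^(lr) into a product of powers of \<alpha> and
  \<open>cnj \<alpha>\<close> with exponents M + lr and M - lr, nonnegative because |lr| \<le> M.
  Multiples of \<pi> contribute only signs.\<close>

lemma cis_freq_lattice:
  "of_int B ^ (nat \<bar>l\<bar> * R) * cis (of_int l * (of_int r * \<phi> + of_int s * pi)) \<in> int_lattice \<alpha>"
  if "\<bar>r\<bar> \<le> int R"
proof -
  define M where "M = int (nat \<bar>l\<bar> * R)"
  have "\<bar>l * r\<bar> \<le> M" unfolding M_def abs_mult using that by (simp add: mult_left_mono)
  hence M: "0 \<le> M + l * r" "0 \<le> M - l * r" by linarith+
  have "of_int B ^ (nat \<bar>l\<bar> * R) * cis (of_int (l * r) * \<phi>) = \<alpha> ^ nat (M + l * r) * cnj \<alpha> ^ nat (M - l * r)"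
  proof -
    have "of_int B ^ (nat \<bar>l\<bar> * R) = (\<alpha> * cnj \<alpha>) powi M"
      by (simp only: M_def power_int_of_nat norm)
    moreover have "cis (of_int (l * r) * \<phi>) = (\<alpha> / cnj \<alpha>) powi (l * r)"
      unfolding quot by (simp add: cis_power_int)
    moreover have "\<alpha> ^ nat (M + l * r) * cnj \<alpha> ^ nat (M - l * r) = \<alpha> powi (M + l * r) * cnj \<alpha> powi (M - l * r)"
      using M by (simp add: power_int_def)
    ultimately show ?thesis using alpha_nonzero
      by (simp add: power_int_mult_distrib power_int_divide_distrib power_int_add power_int_diff)
  qed
  moreover have "cis (of_int (l * s) * pi) \<in> int_lattice \<alpha>"
  proof -
    have "cis (of_int (l * s) * pi) = (-1) powi (l * s)"
      by (simp add: cis_power_int flip: cis_pi)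
    also have "\<dots> = of_int 1 \<or> \<dots> = of_int (-1)" by (auto simp: power_int_minus_left)
    finally show ?thesis using int_lattice_of_int by metis
  qed
  moreover have "cis (of_int l * (of_int r * \<phi> + of_int s * pi)) = cis (of_int (l * r) * \<phi>) * cis (of_int (l * s) * pi)"
    by (simp add: cis_mult algebra_simps)
  ultimately show ?thesis
    using int_lattice_mult[OF trace norm] int_lattice_power[OF trace norm] int_lattice_cnj[OF trace norm]
    by (simp flip: mult.assoc)
qed

lemma entry_lattice: "x \<in> points \<Longrightarrow> entry i x \<in> int_lattice \<alpha>"
proof -
  assume x: "x \<in> points"
  have "(of_int (node x) :: complex) gchoose (i div L) \<in> int_lattice \<alpha>"
    unfolding of_int_gbinomial[symmetric] by simp
  moreover have "of_real (scale i) * cis (of_int (freq i) * angle x) \<in> int_lattice \<alpha>"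
    using cis_freq_lattice[of "fst x" "8 * p" "freq i" "snd x"] x
    by (auto simp: scale_def angle_def points_def)
  ultimately show ?thesis unfolding entry_def mult.assoc by (rule int_lattice_mult[OF trace norm])
qed

text \<open>\<alpha>^(2m) - \<open>cnj \<alpha>\<close>^(2m) is a nonzero lattice element, hence of
  absolute value at least 1. The exponent is even because m \<phi> is going to be close to a
  multiple of \<pi>, not of 2 \<pi>.\<close>

lemma liouville:
  assumes "m \<ge> 1"
  shows "1 \<le> of_int B ^ m * cmod (cis \<phi> ^ (2 * m) - 1)"
proof -
  have "cis \<phi> ^ (2 * m) \<noteq> 1" using not_unity[of "2 * m"] assms by simp
  moreover have eq: "cnj \<alpha> ^ (2 * m) * (cis \<phi> ^ (2 * m) - 1) = \<alpha> ^ (2 * m) + of_int (- 1) * cnj \<alpha> ^ (2 * m)"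
    using alpha_nonzero unfolding quot[symmetric] by (simp add: field_simps power_divide)
  ultimately have "\<alpha> ^ (2 * m) + of_int (- 1) * cnj \<alpha> ^ (2 * m) \<noteq> 0"
    using alpha_nonzero by (metis complex_cnj_zero_iff mult_eq_0_iff power_not_zero right_minus_eq)
  moreover have "\<alpha> ^ (2 * m) + of_int (- 1) * cnj \<alpha> ^ (2 * m) \<in> int_lattice \<alpha>"
    by (intro int_lattice_add int_lattice_mult[OF trace norm] int_lattice_power[OF trace norm]
        int_lattice_of_int int_lattice_self int_lattice_cnj[OF trace norm])
  ultimately have "1 \<le> cmod (\<alpha> ^ (2 * m) + of_int (- 1) * cnj \<alpha> ^ (2 * m))"
    by (intro int_lattice_norm_ge_1[OF trace norm])
  also have "\<dots> = ((cmod \<alpha>)\<^sup>2) ^ m * cmod (cis \<phi> ^ (2 * m) - 1)"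
    unfolding eq[symmetric] by (simp add: norm_mult norm_power power_mult)
  also have "(cmod \<alpha>)\<^sup>2 = of_int B"
    using complex_norm_square[of \<alpha>] unfolding norm by (metis of_real_eq_iff of_real_of_int_eq of_real_power)
  finally show ?thesis .
qed

text \<open>This takes the place of coprimality of k and n. If m k = s n, then m \<phi> differs from
  s \<pi> by only m \<Lambda> / n, which is too close for \<open>liouville\<close>. The range 14p is
  the width of the set of first coordinates to which the zero estimate is applied.\<close>

lemma node_separated:
  assumes "1 \<le> m" "m \<le> 14 * p"
  shows "int m * k \<noteq> s * int n"
proof
  assume eq: "int m * k = s * int n"
  have "real n * (real m * \<phi>) = real n * (of_int s * pi + real m * \<Lambda> / real n)"
  proof -
    have "real m * of_int k = of_int s * real n" using arg_cong[OF eq, of real_of_int] by simp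
    hence "real m * (of_int k * pi) = of_int s * real n * pi" by (metis mult.assoc)
    thus ?thesis using n_ge by (simp add: field_simps)
  qed
  hence "real m * \<phi> = of_int s * pi + real m * \<Lambda> / real n" using n_ge by simp
  hence "real (2 * m) * \<phi> = of_int s * (2 * pi) + 2 * real m * \<Lambda> / real n" by simp
  moreover have "cis (of_int s * (2 * pi)) = 1"
    using cis_multiple_2pi[of "of_int s"] by (simp add: mult_ac)
  ultimately have "cis \<phi> ^ (2 * m) = cis (2 * real m * \<Lambda> / real n)"
    unfolding Complex.DeMoivre by (simp add: cis_mult[symmetric])
  hence "cmod (cis \<phi> ^ (2 * m) - 1) \<le> \<bar>2 * real m * \<Lambda> / real n\<bar>"
    using norm_cis_diff_le[of "2 * real m * \<Lambda> / real n" 0] by simp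
  also have "\<dots> = 2 * real m * \<bar>\<Lambda>\<bar> / real n" by (simp add: abs_mult)
  also have "\<dots> \<le> 2 * real m * \<bar>\<Lambda>\<bar> / 1"
    using n_ge by (intro divide_left_mono) auto
  also have "\<dots> \<le> 2 * (14 * real p) * exp (- real (50 * c * p * (2 * p + 1) + p))"
    using of_nat_mono[OF assms(2), where 'a = real] unfolding div_by_1 by (intro mult_mono small) auto
  finally have small': "cmod (cis \<phi> ^ (2 * m) - 1) \<le> \<dots>" .
  have "of_int B ^ m \<le> exp (real c) ^ m" using B_le B_pos by (intro power_mono) auto
  also have "\<dots> = exp (real (m * c))" by (simp flip: exp_of_nat_mult)
  also have "\<dots> \<le> exp (real (14 * p * c))"
    unfolding exp_le_cancel_iff of_nat_le_iff using assms by (intro mult_right_mono) auto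
  finally have "1 \<le> exp (real (14 * p * c)) * (2 * (14 * real p) * exp (- real (50 * c * p * (2 * p + 1) + p)))"
    using liouville[OF assms(1)] small' B_pos
    by (elim order_trans) (intro mult_mono, auto)
  also have "\<dots> = 2 * (14 * real p) * exp (real (14 * p * c) - real (50 * c * p * (2 * p + 1) + p))"
    by (simp only: diff_conv_add_uminus exp_add, simp only: mult_ac)
  also have "\<dots> \<le> 2 * (14 * exp (real p)) * exp (real (14 * p * c) - real (50 * c * p * (2 * p + 1) + p))"
    by (intro mult_right_mono mult_left_mono order_trans[OF _ exp_ge_add_one_self[of "real p"]]) auto
  also have "\<dots> = 28 * exp (real (14 * p * c) - real (50 * c * p * (2 * p + 1)))"
    by (simp flip: exp_add)
  also have "\<dots> \<le> 28 * exp (- 36)"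
  proof -
    have "1 \<le> c * p" using c_ge p_ge by (cases "c * p") auto
    hence "14 * p * c + 36 \<le> 50 * c * p" by simp
    also have "\<dots> \<le> 50 * c * p * (2 * p + 1)" by simp
    finally have "real (14 * p * c + 36) \<le> real (50 * c * p * (2 * p + 1))" by (rule of_nat_mono)
    thus ?thesis by simp
  qed
  finally have "exp 36 \<le> (28 :: real)" by (simp add: exp_minus field_simps)
  thus False using exp_ge_add_one_self[of "36 :: real"] by simp
qed

lemma angle_eq: "angle x = pi / real n * of_int (node x) + of_int (fst x) * (\<Lambda> / real n)"
  using n_ge by (simp add: angle_def node_def field_simps)

text \<open>Up to the unit cis(angle)^(-p), which shifts the frequencies to 0, ..., 2p, a
  combination of the rows is a polynomial F(X, Y) = \<Sum> P_l(X) Y^l at X = node, Y = cis(angle).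
  If it vanished at all points, the zero estimate would be violated.\<close>

lemma entries_independent:
  assumes "\<exists>i<N. a i \<noteq> 0"
  shows "\<exists>x\<in>points. (\<Sum>i<N. a i * entry i x) \<noteq> 0"
proof (rule ccontr)
  assume "\<not> ?thesis"
  hence zero: "\<And>x. x \<in> points \<Longrightarrow> (\<Sum>i<N. a i * entry i x) = 0" by blast
  define b where "b \<kappa> l = a (\<kappa> * L + l) * of_real (scale (\<kappa> * L + l))" for \<kappa> l
  define P where "P l = (\<Sum>\<kappa><K. smult (b \<kappa> l) (gchoose_poly \<kappa>))" for l
  have sum: "(\<Sum>i<N. a i * entry i x) = cis (angle x) powi (- int p) *
      (\<Sum>l<L. poly (P l) (of_int (node x)) * cis (angle x) ^ l)" for x
  proof -
    have cis: "cis (of_int (int l - int p) * angle x) = cis (angle x) powi (- int p) * cis (angle x) ^ l" for l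
      by (simp add: cis_power_int Complex.DeMoivre cis_mult algebra_simps)
    have "(\<Sum>i<N. a i * entry i x) = (\<Sum>i<N. b (i div L) (i mod L) * (of_int (node x) gchoose (i div L)) *
        cis (of_int (int (i mod L) - int p) * angle x))"
      unfolding entry_def b_def freq_def div_mult_mod_eq by (intro sum.cong refl) (simp only: mult_ac)
    also have "\<dots> = (\<Sum>\<kappa><K. \<Sum>l<L. b \<kappa> l * (of_int (node x) gchoose \<kappa>) * cis (of_int (int l - int p) * angle x))"
      by (rule sum_div_mod) simp
    also have "\<dots> = (\<Sum>l<L. \<Sum>\<kappa><K. b \<kappa> l * (of_int (node x) gchoose \<kappa>) * cis (of_int (int l - int p) * angle x))"
      by (rule sum.swap)
    also have "\<dots> = cis (angle x) powi (- int p) *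
      (\<Sum>l<L. poly (P l) (of_int (node x)) * cis (angle x) ^ l)"
      unfolding sum_distrib_left P_def poly_sum sum_distrib_right
      by (intro sum.cong refl) (simp only: poly_smult poly_gchoose_poly cis, simp only: mult_ac)
    finally show ?thesis .
  qed
  \<comment> \<open>The upper end is 6p instead of 8p, so that the translates by j \<le> 2p in the
    first coordinate stay among the points.\<close>
  define E' where "E' = {- int (8 * p)..int (6 * p)} \<times> {- int (2 * c * p)..int (2 * c * p)}"
  have inj: "inj_on (\<lambda>x. of_int (node x) :: complex) E'"
  proof (rule inj_onI)
    have aux: "x = y" if "x \<in> E'" "y \<in> E'" "node x = node y" "fst y \<le> fst x" for x y
    proof -
      have eq: "(fst x - fst y) * k = (snd y - snd x) * int n"
        using that(3) by (simp add: node_def algebra_simps)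
      have "fst x = fst y"
      proof (rule ccontr)
        assume "fst x \<noteq> fst y"
        hence "1 \<le> nat (fst x - fst y)" "nat (fst x - fst y) \<le> 14 * p"
          using that by (auto simp: E'_def)
        from node_separated[OF this, of "snd y - snd x"] show False using eq that(4) by simp
      qed
      thus "x = y" using eq n_ge by (simp add: prod_eq_iff)
    qed
    fix x y assume "x \<in> E'" "y \<in> E'" "(of_int (node x) :: complex) = of_int (node y)"
    thus "x = y" using aux[of x y] aux[of y x] by (cases "fst y \<le> fst x") auto
  qed
  define E where "E = (\<lambda>x. of_int (node x) :: complex) ` E'"
  \<comment> \<open>In the zero estimate \<eta> is a function of X alone, so the point has to be
    recovered from its node.\<close>
  define pt where "pt = the_inv_into E' (\<lambda>x. of_int (node x) :: complex)"
  have pt: "pt (of_int (node x)) = x" if "x \<in> E'" for x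
    unfolding pt_def using the_inv_into_f_f[OF inj that] .
  have cardE: "card E = (14 * p + 1) * (4 * c * p + 1)"
  proof -
    have "nat (int (6 * p) - - int (8 * p) + 1) = 14 * p + 1"
      "nat (int (2 * c * p) - - int (2 * c * p) + 1) = 4 * c * p + 1"
      by (auto simp: nat_eq_iff)
    hence "card E' = (14 * p + 1) * (4 * c * p + 1)"
      unfolding E'_def card_cartesian_product card_atLeastAtMost_int by (simp only:)
    thus ?thesis unfolding E_def card_image[OF inj] .
  qed
  have "card E \<le> (K - 1) * L"
  proof (rule zero_estimate)
    show "inj_on (\<lambda>l. cis \<phi> ^ l) {..<L}"
    proof (rule inj_onI)
      have aux: "l = l'" if "cis \<phi> ^ l = cis \<phi> ^ l'" "l' \<le> l" for l l' :: nat
      proof (rule ccontr)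
        assume "l \<noteq> l'"
        hence "l - l' \<ge> 1" using that by simp
        moreover have "cis \<phi> ^ (l - l') = 1" using that by (simp add: power_diff)
        ultimately show False using not_unity by blast
      qed
      show "l = l'" if "cis \<phi> ^ l = cis \<phi> ^ l'" for l l' :: nat
        using aux[of l l'] aux[of l' l] that by (cases "l' \<le> l") auto
    qed
    show "degree (P l) < K" for l
    proof -
      have "degree (P l) \<le> K - 1" unfolding P_def
        by (intro degree_sum_le) (auto intro!: order_trans[OF degree_smult_le] simp: degree_gchoose_poly)
      thus ?thesis using c_ge p_ge by (cases K) auto
    qed
    show "\<exists>l<L. P l \<noteq> 0"
    proof -
      obtain i where i: "i < N" "a i \<noteq> 0" using assms by blast
      have "i div L < K" using i by (simp add: less_mult_imp_div_less)
      moreover have "b (i div L) (i mod L) \<noteq> 0"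
        unfolding b_def div_mult_mod_eq scale_def using i B_pos by simp
      ultimately have "P (i mod L) \<noteq> 0"
        using sum_smult_degree_eq_0[of K gchoose_poly "\<lambda>\<kappa>. b \<kappa> (i mod L)" "i div L"]
        by (auto simp: P_def degree_gchoose_poly gchoose_poly_nonzero)
      thus ?thesis by (intro exI[of _ "i mod L"]) simp
    qed
    show "finite E" by (simp add: E_def E'_def)
    show "cis (angle (pt x)) \<noteq> 0" for x by simp
    show "cis \<phi> \<noteq> 0" by simp
    fix y j assume "y \<in> E" and j: "j < L"
    then obtain x where x: "x \<in> E'" "y = of_int (node x)" by (auto simp: E_def)
    define x' where "x' = (fst x + int j, snd x)"
    have "x' \<in> points" using x(1) j by (auto simp: x'_def E'_def points_def)
    from zero[OF this] have "(\<Sum>l<L. poly (P l) (of_int (node x')) * cis (angle x') ^ l) = 0"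
      unfolding sum by simp
    moreover have "of_int (node x') = y + of_nat j * of_int k"
      by (simp add: x x'_def node_def algebra_simps)
    moreover have "cis (angle x') = cis \<phi> ^ j * cis (angle (pt y))"
      by (simp add: x pt[OF x(1)] x'_def angle_def Complex.DeMoivre cis_mult algebra_simps)
    ultimately show "(\<Sum>l<L. poly (P l) (y + of_nat j * of_int k) * (cis \<phi> ^ j * cis (angle (pt y))) ^ l) = 0"
      by simp
  qed
  also have "(K - 1) * L \<le> K * L" by (rule mult_le_mono1) simp
  also have "\<dots> = 50 * c * p * p + 25 * c * p" by (simp add: algebra_simps)
  \<comment> \<open>The leading coefficients of c p^2 are 14 * 4 = 56 against 25 * 2 = 50; the
    excess 6 c p^2 outweighs 25 c p.\<close>
  also have "\<dots> < (14 * p + 1) * (4 * c * p + 1)"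
  proof -
    have "10 * (c * p) \<le> p * (c * p)" using p_ge by (intro mult_right_mono) auto
    moreover have "(14 * p + 1) * (4 * c * p + 1) = 56 * (p * (c * p)) + 14 * p + 4 * (c * p) + 1"
      by (simp add: algebra_simps)
    moreover have "50 * c * p * p + 25 * c * p = 50 * (p * (c * p)) + 25 * (c * p)" by simp
    ultimately show ?thesis by linarith
  qed
  finally show False using cardE by simp
qed

section \<open>Upper bounds for the rows\<close>

definition radius :: real where
  "radius = pi * real ((8 + 2 * c) * p)"

text \<open>The larger semi-axis of the Bernstein ellipse with parameter e^2 over the real interval
  of half-length \<open>radius\<close>.\<close>

definition ellipse :: real where
  "ellipse = radius * ((exp 2 + 1 / exp 2) / 2)"

definition row_bound :: "nat \<Rightarrow> real" where
  "row_bound i = (real n / pi * ellipse + real (i div L)) ^ (i div L) / fact (i div L) * scale i *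
     exp (\<bar>of_int (freq i)\<bar> * ellipse)"

lemma radius_pos: "radius > 0"
  using p_ge by (auto simp: radius_def)

lemma radius_le_ellipse: "radius \<le> ellipse"
proof -
  have "exp 2 = (exp 1 :: real)\<^sup>2" by (simp flip: exp_of_nat_mult)
  hence "exp 2 + 1 / exp 2 - 2 = (exp 1 - 1 / exp 1 :: real)\<^sup>2"
    by (simp add: power2_eq_square field_simps)
  also have "\<dots> \<ge> 0" by simp
  finally have "1 \<le> (exp 2 + 1 / exp 2 :: real) / 2" by simp
  from mult_left_mono[OF this less_imp_le[OF radius_pos]]
  show ?thesis by (simp add: ellipse_def)
qed

lemma ellipse_pos: "ellipse > 0"
  using radius_pos radius_le_ellipse by linarith

lemma scale_pos: "scale i > 0"
  using B_pos by (simp add: scale_def)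

lemma row_bound_nonneg: "row_bound i \<ge> 0"
  unfolding row_bound_def using scale_pos[of i] ellipse_pos
  by (intro mult_nonneg_nonneg divide_nonneg_pos zero_le_power add_nonneg_nonneg) auto

lemma node_le:
  assumes "x \<in> points"
  shows "\<bar>real_of_int (node x)\<bar> \<le> real n / pi * radius"
proof -
  have "\<bar>node x\<bar> \<le> \<bar>fst x\<bar> * \<bar>k\<bar> + \<bar>snd x\<bar> * \<bar>int n\<bar>"
    unfolding node_def abs_mult[symmetric] by (rule abs_triangle_ineq)
  also have "\<dots> \<le> int (8 * p) * int n + int (2 * c * p) * int n"
    using assms k_le by (intro add_mono mult_mono) (auto simp: points_def)
  finally have "real_of_int \<bar>node x\<bar> \<le> real_of_int (int (8 * p) * int n + int (2 * c * p) * int n)"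
    by (simp only: of_int_le_iff)
  thus ?thesis by (simp add: radius_def algebra_simps)
qed

text \<open>In |\<Lambda>| \<le> e^(-2N-p) the part e^(-p) pays for the factor |l r| \<le> 8 p^2,
  and e^(-2N) is the truncation error for the parameter e^2.\<close>

lemma phase_error:
  assumes "x \<in> points"
  shows "\<bar>of_int (freq i) * angle x - of_int (freq i) * (pi / real n * of_int (node x))\<bar> \<le> 1 / exp 2 ^ N"
proof -
  have "\<bar>freq i * fst x\<bar> \<le> int p * int (8 * p)"
    unfolding abs_mult using assms freq_le[of i] by (intro mult_mono) (auto simp: points_def)
  hence "real_of_int \<bar>freq i * fst x\<bar> \<le> real_of_int (int p * int (8 * p))" by (simp only: of_int_le_iff)
  hence le: "\<bar>real_of_int (freq i) * of_int (fst x)\<bar> \<le> 8 * (real p)\<^sup>2"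
    by (simp add: power2_eq_square)
  have "\<bar>of_int (freq i) * angle x - of_int (freq i) * (pi / real n * of_int (node x))\<bar> =
      \<bar>of_int (freq i) * of_int (fst x)\<bar> * (\<bar>\<Lambda>\<bar> / real n)"
    by (simp only: angle_eq distrib_left add_diff_cancel_left' mult.assoc[symmetric] abs_mult abs_divide abs_of_nat)
  also have "\<dots> \<le> (8 * (real p)\<^sup>2) * (\<bar>\<Lambda>\<bar> / 1)"
    using n_ge by (intro mult_mono le divide_left_mono) auto
  also have "\<dots> \<le> exp (real p) * exp (- real (50 * c * p * (2 * p + 1) + p))"
    unfolding div_by_1
  proof (intro mult_mono small)
    have "10 ^ 3 \<le> real p ^ 3" using p_ge by (intro power_mono) auto
    \<comment> \<open>960 = 8 * 5!, so that 8 p^2 lies below the term p^5 / 5! of the series of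
      e^p.\<close>
    hence "(real p)\<^sup>2 * 960 \<le> (real p)\<^sup>2 * real p ^ 3" by (intro mult_left_mono) auto
    hence "8 * (real p)\<^sup>2 \<le> (real p)\<^sup>2 * real p ^ 3 / 120" by simp
    also have "\<dots> = real p ^ 5 / fact 5" by (simp add: fact_numeral flip: power_add)
    also have "\<dots> \<le> exp (real p)" using power_div_fact_le[of "real p" "real p" 5] p_ge by simp
    finally show "8 * (real p)\<^sup>2 \<le> exp (real p)" .
  qed auto
  also have "\<dots> = exp (- real (2 * N))" by (simp flip: exp_add)
  also have "\<dots> = 1 / exp 2 ^ N"
  proof -
    have "exp 2 ^ N = exp (real (2 * N))"
      unfolding exp_of_nat_mult[symmetric] by (simp only: of_nat_mult of_nat_numeral mult_ac)
    thus ?thesis by (simp only: exp_minus inverse_eq_divide)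
  qed
  finally show ?thesis .
qed

text \<open>5 = 2 * 2 + 1: a factor 2 each from the power bound and from the exponential, plus one
  \<open>row_bound\<close> for replacing the angle by its multiple of the node.\<close>

lemma entry_cheb_bounded:
  "cheb_bounded (exp 2) N points (\<lambda>x. arccos (pi / real n * of_int (node x) / radius)) (entry i) (5 * row_bound i)"
proof -
  define \<kappa> where "\<kappa> = i div L"
  define l where "l = real_of_int (freq i)"
  define z where "z x = pi / real n * of_int (node x)" for x
  define \<theta> where "\<theta> x = arccos (z x / radius)" for x
  define a where "a = real n / pi"
  define Y where "Y = a * ellipse + real \<kappa>"
  define f where "f x = (\<Prod>j<\<kappa>. of_real a * of_real (z x) - of_nat j :: complex)" for x
  have a: "a > 0" using n_ge by (simp add: a_def)
  have Y: "Y > 0" using a ellipse_pos unfolding Y_def by (intro add_pos_nonneg mult_pos_pos) auto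
  have z: "radius * cos (\<theta> x) = z x" if "x \<in> points" for x
  proof -
    have "\<bar>z x\<bar> = pi / real n * \<bar>of_int (node x)\<bar>" by (simp add: z_def abs_mult)
    also have "\<dots> \<le> pi / real n * (real n / pi * radius)"
      by (intro mult_left_mono node_le that) auto
    also have "\<dots> = radius" using n_ge by simp
    finally have "\<bar>z x / radius\<bar> \<le> 1" using radius_pos by (simp add: field_simps)
    thus ?thesis using radius_pos unfolding \<theta>_def by (subst cos_arccos_abs) auto
  qed
  have "cheb_bounded (exp 2) N points \<theta> (\<lambda>x. of_real (z x) ^ q) (2 * ellipse ^ q)" for q
    unfolding ellipse_def
    by (rule cheb_bounded_cong[OF cheb_bounded_power]) (use radius_pos z in auto)
  from cheb_bounded_falling_product[OF this]
  have "cheb_bounded (exp 2) N points \<theta> (\<lambda>x. f x * of_real (z x) ^ q) (2 * Y ^ \<kappa> * ellipse ^ q)" for q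
    unfolding f_def Y_def using a ellipse_pos by simp
  from cheb_bounded_cmult[OF cheb_bounded_mult_cis[OF this], of "of_real (scale i / fact \<kappa>)" l]
  have main: "cheb_bounded (exp 2) N points \<theta> (\<lambda>x. of_real (scale i / fact \<kappa>) * (f x * cis (l * z x))) (4 * row_bound i)"
    using scale_pos[of i] Y ellipse_pos
    by (simp add: points_def row_bound_def norm_divide \<kappa>_def l_def Y_def a_def mult_ac)
  have "cheb_bounded (exp 2) N points \<theta> (entry i) (4 * row_bound i + row_bound i)"
  proof (rule cheb_bounded_perturb[OF main])
    show "row_bound i \<ge> 0" by (rule row_bound_nonneg)
    fix x assume x: "x \<in> points"
    have fx: "f x = (\<Prod>j<\<kappa>. of_int (node x) - of_nat j)"
      unfolding f_def a_def z_def using n_ge by simp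
    have "entry i x = of_real (scale i / fact \<kappa>) * (f x * cis (l * angle x))"
      by (simp add: entry_def fx \<kappa>_def l_def gbinomial_prod_rev atLeast0LessThan)
    hence "entry i x - of_real (scale i / fact \<kappa>) * (f x * cis (l * z x)) =
        of_real (scale i / fact \<kappa>) * (f x * (cis (l * angle x) - cis (l * z x)))"
      by (simp only: right_diff_distrib)
    hence "norm (entry i x - of_real (scale i / fact \<kappa>) * (f x * cis (l * z x)))
       = scale i / fact \<kappa> * (norm (f x) * norm (cis (l * angle x) - cis (l * z x)))"
      using scale_pos[of i] by (simp add: norm_mult norm_divide)
    also have "\<dots> \<le> scale i / fact \<kappa> * (Y ^ \<kappa> * (1 / exp 2 ^ N))"
    proof (intro mult_left_mono mult_mono)
      have "norm (f x) = (\<Prod>j<\<kappa>. norm (of_int (node x) - of_nat j :: complex))"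
        by (simp add: fx prod_norm)
      also have "\<dots> \<le> (\<Prod>j<\<kappa>. Y)"
      proof (rule prod_mono, safe)
        fix j assume "j < \<kappa>"
        have "norm (of_int (node x) - of_nat j :: complex) \<le> \<bar>of_int (node x)\<bar> + real j"
          by (rule order_trans[OF norm_triangle_ineq4]) simp
        also have "\<dots> \<le> a * radius + real \<kappa>"
          using node_le[OF x] \<open>j < \<kappa>\<close> by (simp add: a_def)
        also have "\<dots> \<le> Y"
          unfolding Y_def using a radius_le_ellipse by simp
        finally show "norm (of_int (node x) - of_nat j :: complex) \<le> Y" .
      qed auto
      finally show "norm (f x) \<le> Y ^ \<kappa>" by simp
      show "norm (cis (l * angle x) - cis (l * z x)) \<le> 1 / exp 2 ^ N"
        using phase_error[OF x, of i] norm_cis_diff_le[of "l * angle x" "l * z x"]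
        unfolding l_def z_def by linarith
    qed (use scale_pos[of i] Y in auto)
    also have "\<dots> = scale i / fact \<kappa> * (Y ^ \<kappa> * (1 / exp 2 ^ N)) * 1" by simp
    also have "\<dots> \<le> scale i / fact \<kappa> * (Y ^ \<kappa> * (1 / exp 2 ^ N)) * exp (\<bar>l\<bar> * ellipse)"
      using scale_pos[of i] Y ellipse_pos by (intro mult_left_mono) auto
    also have "\<dots> = row_bound i / exp 2 ^ N"
      by (simp add: row_bound_def \<kappa>_def l_def Y_def a_def)
    finally show "norm (entry i x - of_real (scale i / fact \<kappa>) * (f x * cis (l * z x))) \<le> row_bound i / exp 2 ^ N" .
  qed simp
  moreover have "4 * row_bound i + row_bound i = 5 * row_bound i" by simp
  ultimately show ?thesis unfolding \<theta>_def z_def by (simp only:)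
qed

lemma ellipse_le: "ellipse \<le> 12.07 * real ((8 + 2 * c) * p)"
proof -
  have "ellipse = pi * ((exp 2 + 1 / exp 2) / 2) * real ((8 + 2 * c) * p)"
    by (simp add: ellipse_def radius_def)
  also have "\<dots> \<le> 3.2 * 3.77 * real ((8 + 2 * c) * p)"
    using pi_le cosh_2_le by (intro mult_mono) (auto intro!: add_nonneg_nonneg)
  also have "\<dots> \<le> 12.07 * real ((8 + 2 * c) * p)" by (intro mult_right_mono) auto
  finally show ?thesis .
qed

text \<open>With t = K/2 in \<open>power_div_fact_le\<close>, each unit of \<kappa> costs at most
  e^(2p). As c \<ge> 7 gives 8 + 2c \<le> 22c/7, the ellipse term needs 3.77 * 22/7 < 12 = 0.96 *
  12.5 in units of cp; the remaining 0.04 covers the summand K.\<close>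

lemma base_le: "(real n / pi * ellipse + real K) / (real K / 2) \<le> exp (2 * real p)"
proof -
  have cp: "real c \<ge> 7" "real p \<ge> 10" using c_ge p_ge by simp_all
  have "real n / pi * ellipse = real n * ((exp 2 + 1 / exp 2) / 2) * real ((8 + 2 * c) * p)"
    by (simp add: ellipse_def radius_def)
  also have "\<dots> \<le> exp (2 * real p) * 3.77 * real ((8 + 2 * c) * p)"
    using n_le cosh_2_le by (intro mult_mono) (auto intro!: add_nonneg_nonneg)
  also have "\<dots> \<le> exp (2 * real p) * 3.77 * (22 / 7 * real c * real p)"
  proof -
    have "(8 + 2 * real c) * real p \<le> 22 / 7 * real c * real p"
      using cp by (intro mult_right_mono) auto
    thus ?thesis by (intro mult_left_mono) auto
  qed
  also have "\<dots> \<le> 0.96 * exp (2 * real p) * (real K / 2)" by simp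
  finally have "real n / pi * ellipse + real K \<le> (0.96 * exp (2 * real p) + 2) * (real K / 2)"
    by (simp add: algebra_simps)
  moreover have "2 \<le> 0.04 * exp (2 * real p)"
  proof -
    have "(2 * real p) ^ 2 / fact 2 \<le> exp (2 * real p)"
      using power_div_fact_le[of "2 * real p" "2 * real p" 2] cp by simp
    moreover have "10 ^ 2 \<le> real p ^ 2" using cp by (intro power_mono) auto
    ultimately show ?thesis by (simp add: power_mult_distrib)
  qed
  ultimately have "real n / pi * ellipse + real K \<le> exp (2 * real p) * (real K / 2)"
    by (elim order_trans) (intro mult_right_mono, auto)
  moreover have "real K / 2 > 0" using cp by simp
  ultimately show ?thesis by (simp add: pos_divide_le_eq)
qed

lemma row_bound_le:
  assumes "i < N"
  shows "row_bound i \<le> exp (2 * real p * real (i div L) + real K / 2 +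
    \<bar>of_int (freq i)\<bar> * (ellipse + real c * real (8 * p)))"
proof -
  let ?\<kappa> = "i div L" and ?l = "\<bar>real_of_int (freq i)\<bar>"
  let ?y = "real n / pi * ellipse"
  have Kpos: "real K / 2 > 0" using c_ge p_ge by simp
  have y: "?y \<ge> 0" using ellipse_pos by simp
  have "?\<kappa> < K" using assms by (simp add: less_mult_imp_div_less)
  hence "real ?\<kappa> \<le> real K" unfolding of_nat_le_iff by (rule less_imp_le)
  hence "(?y + real ?\<kappa>) ^ ?\<kappa> \<le> (?y + real K) ^ ?\<kappa>" using y by (intro power_mono add_left_mono) auto
  hence "(?y + real ?\<kappa>) ^ ?\<kappa> / fact ?\<kappa> \<le> (?y + real K) ^ ?\<kappa> / fact ?\<kappa>"
    by (intro divide_right_mono) auto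
  also have "\<dots> \<le> ((?y + real K) / (real K / 2)) ^ ?\<kappa> * exp (real K / 2)"
    using y Kpos by (intro power_div_fact_le) auto
  also have "\<dots> \<le> exp (2 * real p) ^ ?\<kappa> * exp (real K / 2)"
    using y Kpos
    by (intro mult_right_mono power_mono base_le divide_nonneg_pos add_nonneg_nonneg) auto
  also have "\<dots> = exp (2 * real p * real ?\<kappa> + real K / 2)"
    by (simp add: exp_add mult.commute flip: exp_of_nat_mult)
  finally have 1: "(?y + real ?\<kappa>) ^ ?\<kappa> / fact ?\<kappa> \<le> \<dots>" .
  have "scale i \<le> exp (real c) ^ (nat \<bar>freq i\<bar> * (8 * p))"
    unfolding scale_def using B_le B_pos by (intro power_mono) auto
  also have "\<dots> = exp (?l * (real c * real (8 * p)))"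
    by (simp add: mult_ac flip: exp_of_nat_mult)
  finally have 2: "scale i \<le> \<dots>" .
  have "row_bound i \<le> exp (2 * real p * real ?\<kappa> + real K / 2) * exp (?l * (real c * real (8 * p))) * exp (?l * ellipse)"
    unfolding row_bound_def using 1 2 scale_pos[of i] by (intro mult_mono) auto
  also have "\<dots> = exp (2 * real p * real ?\<kappa> + real K / 2 + ?l * (ellipse + real c * real (8 * p)))"
    by (simp add: algebra_simps flip: exp_add)
  finally show ?thesis .
qed

lemma row_bound_sum:
  "(\<Sum>i<N. 2 * real p * real (i div L) + real K / 2 + \<bar>of_int (freq i)\<bar> * V) =
   real p * (real N * (real K - 1)) + real N * (real K / 2) + V * (real K * real (p * (p + 1)))"
proof -
  have abs: "(\<Sum>m<L. \<bar>real_of_int (int m - int p)\<bar>) = real (p * (p + 1))"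
  proof -
    have "(\<Sum>m<L. \<bar>real_of_int (int m - int p)\<bar>) = real_of_int (\<Sum>m<L. \<bar>int m - int p\<bar>)"
      by (simp only: of_int_sum of_int_abs)
    also have "\<dots> = real (p * (p + 1))" unfolding sum_abs_centered by (simp add: algebra_simps)
    finally show ?thesis .
  qed
  have linear: "(\<Sum>\<kappa><M. a * (2 * real \<kappa>) + b) = a * (real M * (real M - 1)) + real M * b" for M a b
    by (induction M) (auto simp: algebra_simps)
  have "(\<Sum>i<N. 2 * real p * real (i div L) + real K / 2 + \<bar>of_int (freq i)\<bar> * V) =
     (\<Sum>\<kappa><K. \<Sum>m<L. 2 * real p * real \<kappa> + real K / 2 + \<bar>real_of_int (int m - int p)\<bar> * V)"
    unfolding freq_def by (rule sum_div_mod) simp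
  also have "\<dots> = (\<Sum>\<kappa><K. real L * (2 * real p * real \<kappa> + real K / 2) + real (p * (p + 1)) * V)"
    by (rule sum.cong[OF refl])
      (simp only: sum.distrib sum_distrib_right[symmetric] abs sum_constant card_lessThan distrib_left)
  also have "\<dots> = (\<Sum>\<kappa><K. real L * real p * (2 * real \<kappa>) + (real L * (real K / 2) + real (p * (p + 1)) * V))"
    by (simp only: distrib_left mult_ac add.assoc)
  also have "\<dots> = real L * real p * (real K * (real K - 1)) + real K * (real L * (real K / 2) + real (p * (p + 1)) * V)"
    by (rule linear)
  also have "\<dots> = real p * (real N * (real K - 1)) + real N * (real K / 2) + V * (real K * real (p * (p + 1)))"
  proof -
    have "l * q * (y * (y - 1)) + y * (l * (y / 2) + w * V) = q * (y * l * (y - 1)) + y * l * (y / 2) + V * (y * w)"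
      for l q y w :: real by (simp add: algebra_simps)
    thus ?thesis unfolding of_nat_mult[of K L] .
  qed
  finally show ?thesis .
qed

lemma contradiction: False
proof -
  define n0 where "n0 = real N"
  have n0: "n0 > 0" unfolding n0_def of_nat_0_less_iff using c_ge p_ge by simp
  obtain xs where xs: "\<forall>j<N. xs j \<in> points" and nz: "det (mat N N (\<lambda>(i, j). entry i (xs j))) \<noteq> 0"
    using nonzero_minor[of N points entry] entries_independent by blast
  have "det (mat N N (\<lambda>(i, j). entry i (xs j))) \<in> int_lattice \<alpha>"
    using xs by (intro int_lattice_det[OF trace norm] entry_lattice) auto
  hence "1 \<le> cmod (det (mat N N (\<lambda>(i, j). entry i (xs j))))"
    using nz by (rule int_lattice_norm_ge_1[OF trace norm])
  also have "\<dots> \<le> real (2 * N) ^ N * ((\<Prod>i<N. 5 * row_bound i) * (1 / exp 2) ^ (\<Sum>i<N. i) * fact N)"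
    by (rule cheb_bounded_det[OF entry_cheb_bounded])
      (use xs row_bound_nonneg in auto)
  also have "\<dots> \<le> real (2 * N) ^ N * ((8 ^ N * exp (real p * (n0 * (real K - 1)) + n0 * (real K / 2) +
      (ellipse + real c * real (8 * p)) * (real K * real (p * (p + 1))))) * exp (- (n0 * (n0 - 1))) * real N ^ N)"
  proof (intro mult_left_mono mult_mono)
    \<comment> \<open>Rounding 5 up to 8 makes the logarithmic losses 2N * 8 * N = 16 N^2, the
      fourth power of 2 sqrt N.\<close>
    have "(\<Prod>i<N. 5 * row_bound i) \<le> (\<Prod>i<N. 8 * exp (2 * real p * real (i div L) + real K / 2 +
        \<bar>of_int (freq i)\<bar> * (ellipse + real c * real (8 * p))))"
      using row_bound_nonneg by (intro prod_mono conjI mult_mono row_bound_le) auto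
    also have "\<dots> = 8 ^ N * exp (\<Sum>i<N. 2 * real p * real (i div L) + real K / 2 +
        \<bar>of_int (freq i)\<bar> * (ellipse + real c * real (8 * p)))"
      by (simp only: prod.distrib prod_constant card_lessThan exp_sum[OF finite_lessThan])
    finally show "(\<Prod>i<N. 5 * row_bound i) \<le> 8 ^ N * exp (real p * (n0 * (real K - 1)) + n0 * (real K / 2) +
      (ellipse + real c * real (8 * p)) * (real K * real (p * (p + 1))))"
      unfolding row_bound_sum n0_def .
    define S where "S = (\<Sum>i<N. i)"
    have "2 * real (\<Sum>i<M. i) = real M * (real M - 1)" for M
      by (induction M) (auto simp: algebra_simps)
    hence "n0 * (n0 - 1) = 2 * real S" unfolding S_def n0_def by (rule sym)
    hence "exp (- (n0 * (n0 - 1))) = exp (- 2) ^ S" by (simp flip: exp_of_nat_mult)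
    thus "(1 / exp 2) ^ (\<Sum>i<N. i) \<le> exp (- (n0 * (n0 - 1)))"
      unfolding S_def[symmetric] by (simp add: exp_minus divide_inverse)
    show "fact N \<le> real N ^ N" using fact_le_power[of N] by simp
  qed auto
  also have "real (2 * N) ^ N = exp (n0 * ln (2 * n0))"
    using n0 by (simp add: n0_def powr_realpow[symmetric] powr_def del: of_nat_mult)
  also have "real N ^ N = exp (n0 * ln n0)"
    using n0 by (simp add: n0_def powr_realpow[symmetric] powr_def del: of_nat_mult)
  also have "8 ^ N = exp (n0 * ln 8)"
    using n0 by (simp add: n0_def powr_realpow[symmetric] powr_def del: of_nat_mult)
  also have "exp (n0 * ln (2 * n0)) * ((exp (n0 * ln 8) * exp (real p * (n0 * (real K - 1)) + n0 * (real K / 2) +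
      (ellipse + real c * real (8 * p)) * (real K * real (p * (p + 1))))) * exp (- (n0 * (n0 - 1))) * exp (n0 * ln n0)) =
    exp (n0 * ln (2 * n0) + ((n0 * ln 8 + (real p * (n0 * (real K - 1)) + n0 * (real K / 2) +
      (ellipse + real c * real (8 * p)) * (real K * real (p * (p + 1))))) + - (n0 * (n0 - 1)) + n0 * ln n0))"
    by (simp only: exp_add)
  finally have "0 \<le> n0 * ln (2 * n0) + ((n0 * ln 8 + (real p * (n0 * (real K - 1)) + n0 * (real K / 2) +
      (ellipse + real c * real (8 * p)) * (real K * real (p * (p + 1))))) + - (n0 * (n0 - 1)) + n0 * ln n0)"
    by (simp only: one_le_exp_iff)
  hence "n0 * (n0 - 1) \<le> n0 * (ln (2 * n0) + ln n0 + ln 8) + real p * (n0 * (real K - 1)) + n0 * (real K / 2) +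
      (ellipse + real c * real (8 * p)) * (real K * real (p * (p + 1)))"
    unfolding distrib_left[of n0] by linarith
  also have "ln (2 * n0) + ln n0 + ln 8 = ln (16 * n0\<^sup>2)"
    using n0 by (simp add: power2_eq_square flip: ln_mult_pos)
  also have "n0 * ln (16 * n0\<^sup>2) + real p * (n0 * (real K - 1)) + n0 * (real K / 2) +
      (ellipse + real c * real (8 * p)) * (real K * real (p * (p + 1))) < n0 * (n0 - 1)"
    by (rule parameters_suffice[OF p_ge c_ge refl _ ellipse_le]) (simp only: n0_def of_nat_mult)
  finally show False by simp
qed

end

section \<open>Lucas sequences\<close>

lemma char_roots_sum_prod:
  assumes "char_roots A B \<alpha> \<beta>"
  shows "\<alpha> + \<beta> = of_int A" "\<alpha> * \<beta> = of_int B"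
proof -
  have "[:of_int B, - of_int A, 1:] = [:\<alpha> * \<beta>, - (\<alpha> + \<beta>), 1:]"
    using assms by (simp add: char_roots_def)
  hence "of_int B = \<alpha> * \<beta>" "- of_int A = - (\<alpha> + \<beta>)" by (simp_all only: pCons_eq_iff)
  thus "\<alpha> + \<beta> = of_int A" "\<alpha> * \<beta> = of_int B" by (simp_all only: neg_equal_iff_equal)
qed

lemma lucas_U_closed_form:
  fixes \<alpha> \<beta> :: "'a::comm_ring_1"
  assumes "\<alpha> + \<beta> = of_int A" "\<alpha> * \<beta> = of_int B"
  shows "of_int (lucas_U A B n) * (\<alpha> - \<beta>) = \<alpha> ^ n - \<beta> ^ n"
proof (induction n rule: induct_nat_012)
  case (ge2 n)
  have "of_int (lucas_U A B (Suc (Suc n))) * (\<alpha> - \<beta>) =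
      of_int A * (of_int (lucas_U A B (Suc n)) * (\<alpha> - \<beta>)) - of_int B * (of_int (lucas_U A B n) * (\<alpha> - \<beta>))"
    by (simp add: algebra_simps)
  also have "\<dots> = \<alpha> ^ Suc (Suc n) - \<beta> ^ Suc (Suc n)"
    unfolding ge2 assms[symmetric] by (simp add: algebra_simps)
  finally show ?case .
qed auto

text \<open>Up to \<pi>/3 the derivative cos is at least 1/2; from there on sin is at least 0.8,
  while y/2 \<le> \<pi>/4 \<le> 0.8.\<close>

lemma abs_sin_ge:
  assumes "\<bar>x\<bar> \<le> pi / 2"
  shows "\<bar>x\<bar> / 2 \<le> \<bar>sin x\<bar>"
proof -
  have main: "y / 2 \<le> sin y" if y: "0 \<le> y" "y \<le> pi / 2" for y :: real
  proof (cases "y \<le> pi / 3")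
    case True
    have "(\<lambda>t. sin t - t / 2) 0 \<le> (\<lambda>t. sin t - t / 2) y"
    proof (rule DERIV_nonneg_imp_nondecreasing[OF y(1)])
      fix t assume "0 \<le> t" "t \<le> y"
      hence "cos (pi / 3) \<le> cos t" using True pi_gt_zero by (intro cos_monotone_0_pi_le) linarith+
      hence "cos t - 1 / 2 \<ge> 0" by (simp add: cos_60)
      moreover have "((\<lambda>t. sin t - t / 2) has_real_derivative cos t - 1 / 2) (at t)"
        by (auto intro!: derivative_eq_intros)
      ultimately show "\<exists>d. ((\<lambda>t. sin t - t / 2) has_real_derivative d) (at t) \<and> d \<ge> 0" by blast
    qed
    thus ?thesis by simp
  next
    case False
    have "1.6 \<le> sqrt (3 :: real)" by (rule real_le_rsqrt) (simp add: power2_eq_square)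
    hence "0.8 \<le> sin (pi / 3)" by (simp add: sin_60)
    also have "\<dots> \<le> sin y" using False y pi_gt_zero by (intro sin_monotone_2pi_le) linarith+
    finally show ?thesis using y pi_le by linarith
  qed
  show ?thesis
  proof (cases "x \<ge> 0")
    case True
    thus ?thesis using main[of x] assms by simp
  next
    case False
    thus ?thesis using main[of "- x"] assms by simp
  qed
qed

lemma norm_cis_minus_1_ge:
  assumes "\<bar>x\<bar> \<le> pi"
  shows "\<bar>x\<bar> / 2 \<le> norm (cis x - 1)"
  using abs_sin_ge[of "x / 2"] assms dist_exp_i_1[of x] by (simp add: cis_conv_exp)

text \<open>|U_n| |\<alpha> - \<beta>| = |\<alpha>|^n |cis(n \<phi>) - 1|. One factor 1/2 is lost in
  |cis \<Lambda> - 1| \<ge> |\<Lambda>|/2; the other, with one power of |\<alpha>|, in |\<alpha> -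
  \<beta>| \<le> 2|\<alpha>|.\<close>

lemma lucas_U_lower_bound:
  fixes A B :: int and \<alpha> \<beta> :: complex and n p c :: nat
  assumes sum: "\<alpha> + \<beta> = of_int A" and prod: "\<alpha> * \<beta> = of_int B" and cnj: "\<beta> = cnj \<alpha>"
    and not_unity: "\<not> root_of_unity (\<alpha> / \<beta>)"
    and B: "B > 0" "of_int B \<le> exp (real c)" and p: "p \<ge> 10" and c: "c \<ge> 7"
    and n: "n \<ge> 1" "real n \<le> exp (2 * real p)"
  shows "\<bar>real_of_int (lucas_U A B n)\<bar> \<ge>
    1 / 4 * exp (- real (50 * c * p * (2 * p + 1) + p)) * cmod \<alpha> ^ (n - 1)"
proof -
  define \<epsilon> where "\<epsilon> = exp (- real (50 * c * p * (2 * p + 1) + p))"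
  define \<phi> where "\<phi> = Arg (\<alpha> / \<beta>)"
  \<comment> \<open>An even multiple of \<pi>, so that cis \<Lambda> = cis(n \<phi>); rounding to
    the nearest one gives |\<Lambda>| \<le> \<pi>.\<close>
  define k where "k = 2 * round (real n * \<phi> / (2 * pi))"
  define \<Lambda> where "\<Lambda> = real n * \<phi> - of_int k * pi"
  have \<alpha>0: "\<alpha> \<noteq> 0" and \<beta>0: "\<beta> \<noteq> 0" using prod B by auto
  have "cmod (\<alpha> / \<beta>) = 1" using \<alpha>0 by (simp add: cnj norm_divide)
  hence quot: "\<alpha> / \<beta> = cis \<phi>" unfolding \<phi>_def using \<alpha>0 \<beta>0 by (simp add: cis_Arg sgn_eq)
  have \<phi>: "\<bar>\<phi>\<bar> \<le> pi" unfolding \<phi>_def using Arg_bounded[of "\<alpha> / \<beta>"] by (simp add: abs_le_iff)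
  have "\<bar>real n * \<phi> / (2 * pi) - of_int (round (real n * \<phi> / (2 * pi)))\<bar> \<le> 1 / 2"
    using of_int_round_abs_le[of "real n * \<phi> / (2 * pi)"] by (simp add: abs_minus_commute)
  hence "2 * pi * \<bar>real n * \<phi> / (2 * pi) - of_int (round (real n * \<phi> / (2 * pi)))\<bar> \<le> 2 * pi * (1 / 2)"
    by (intro mult_left_mono) auto
  moreover have "\<Lambda> = 2 * pi * (real n * \<phi> / (2 * pi) - of_int (round (real n * \<phi> / (2 * pi))))"
    by (simp add: \<Lambda>_def k_def field_simps)
  ultimately have \<Lambda>: "\<bar>\<Lambda>\<bar> \<le> pi" by (simp add: abs_mult)
  have "\<epsilon> < \<bar>\<Lambda>\<bar>"
  proof (rule ccontr)
    assume "\<not> \<epsilon> < \<bar>\<Lambda>\<bar>"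
    hence small: "\<bar>\<Lambda>\<bar> \<le> \<epsilon>" by simp
    also have "\<epsilon> \<le> 1" unfolding \<epsilon>_def exp_le_one_iff by (simp only: neg_le_0_iff_le of_nat_0_le_iff)
    finally have \<Lambda>1: "\<bar>\<Lambda>\<bar> \<le> 1" .
    have "real_of_int \<bar>k\<bar> * pi = \<bar>real n * \<phi> - \<Lambda>\<bar>" by (simp add: \<Lambda>_def abs_mult)
    also have "\<dots> \<le> real n * \<bar>\<phi>\<bar> + 1" using \<Lambda>1 abs_triangle_ineq4[of "real n * \<phi>" \<Lambda>] by (simp add: abs_mult)
    also have "\<dots> \<le> real n * pi + 1" using \<phi> by (intro add_mono mult_left_mono) auto
    also have "\<dots> < (real n + 1) * pi" using pi_ge_two by (simp add: algebra_simps)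
    finally have "real_of_int \<bar>k\<bar> < real n + 1" by (simp only: mult_less_cancel_right_pos[OF pi_gt_zero])
    hence k: "\<bar>k\<bar> \<le> int n" by linarith
    have "small_linear_form A B \<alpha> \<phi> k n p c"
    proof
      show "cis \<phi> ^ m \<noteq> 1" if "m \<ge> 1" for m
        using not_unity that unfolding root_of_unity_def quot by blast
    qed (use sum prod cnj quot B p c n k small in \<open>simp_all add: \<epsilon>_def \<Lambda>_def\<close>)
    thus False by (rule small_linear_form.contradiction)
  qed
  moreover have "\<bar>\<Lambda>\<bar> / 2 \<le> cmod (cis \<phi> ^ n - 1)"
  proof -
    have "cis (- (2 * pi * of_int (round (real n * \<phi> / (2 * pi))))) = 1"
      using cis_multiple_2pi[of "- of_int (round (real n * \<phi> / (2 * pi)))"] by simp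
    moreover have "\<Lambda> = real n * \<phi> + - (2 * pi * of_int (round (real n * \<phi> / (2 * pi))))"
      by (simp add: \<Lambda>_def k_def)
    ultimately have "cis \<Lambda> = cis (real n * \<phi>)" by (simp only: cis_mult[symmetric] mult_1_right)
    hence "cis \<phi> ^ n = cis \<Lambda>" by (simp add: Complex.DeMoivre)
    thus ?thesis using norm_cis_minus_1_ge[OF \<Lambda>] by simp
  qed
  ultimately have 1: "\<epsilon> / 2 \<le> cmod (cis \<phi> ^ n - 1)" by linarith
  have n': "cmod \<alpha> ^ n = cmod \<alpha> ^ (n - 1) * cmod \<alpha>" using n by (cases n) auto
  have "cmod (\<alpha> ^ n - \<beta> ^ n) = cmod (\<beta> ^ n * (cis \<phi> ^ n - 1))"
    unfolding quot[symmetric] using \<beta>0 by (simp add: power_divide right_diff_distrib)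
  also have "\<dots> = cmod \<alpha> ^ n * cmod (cis \<phi> ^ n - 1)" by (simp add: norm_mult norm_power cnj)
  also have "\<dots> \<ge> cmod \<alpha> ^ n * (\<epsilon> / 2)" using 1 by (intro mult_left_mono) auto
  finally have "cmod \<alpha> ^ n * (\<epsilon> / 2) \<le> cmod (of_int (lucas_U A B n) * (\<alpha> - \<beta>))"
    unfolding lucas_U_closed_form[OF sum prod] .
  also have "\<dots> = \<bar>real_of_int (lucas_U A B n)\<bar> * cmod (\<alpha> - \<beta>)" by (simp add: norm_mult)
  also have "\<dots> \<le> \<bar>real_of_int (lucas_U A B n)\<bar> * (2 * cmod \<alpha>)"
    using norm_triangle_ineq4[of \<alpha> \<beta>] by (intro mult_left_mono) (auto simp: cnj)
  finally have "cmod \<alpha> * (cmod \<alpha> ^ (n - 1) * (\<epsilon> / 2)) \<le> cmod \<alpha> * (\<bar>real_of_int (lucas_U A B n)\<bar> * 2)"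
    unfolding n' by (simp add: mult_ac)
  hence "cmod \<alpha> ^ (n - 1) * (\<epsilon> / 2) \<le> \<bar>real_of_int (lucas_U A B n)\<bar> * 2"
    using \<alpha>0 by simp
  thus ?thesis unfolding \<epsilon>_def[symmetric] by (simp add: mult_ac)
qed

lemma char_roots_discriminant:
  fixes \<alpha> \<beta> :: complex
  assumes "\<alpha> + \<beta> = of_int A" "\<alpha> * \<beta> = of_int B"
  shows "A\<^sup>2 < 4 * B \<Longrightarrow> \<beta> = cnj \<alpha>" and "A\<^sup>2 > 4 * B \<Longrightarrow> \<alpha> \<in> \<real> \<and> \<beta> \<in> \<real>"
proof -
  have im: "Im \<beta> = - Im \<alpha>" using arg_cong[OF assms(1), of Im] by simp
  have "Im \<alpha> * (Re \<beta> - Re \<alpha>) = Im (\<alpha> * \<beta>)" by (simp add: im algebra_simps)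
  hence "Im \<alpha> * (Re \<beta> - Re \<alpha>) = 0" by (simp add: assms)
  hence cases: "Im \<alpha> = 0 \<or> Re \<beta> = Re \<alpha>" by auto
  have "(\<alpha> - \<beta>)\<^sup>2 = (\<alpha> + \<beta>)\<^sup>2 - 4 * (\<alpha> * \<beta>)" by (simp add: power2_eq_square algebra_simps)
  hence "(\<alpha> - \<beta>)\<^sup>2 = of_int (A\<^sup>2 - 4 * B)" by (simp add: assms)
  hence "Re ((\<alpha> - \<beta>)\<^sup>2) = of_int (A\<^sup>2 - 4 * B)" by (metis Re_complex_of_real of_real_of_int_eq)
  moreover have "Re ((\<alpha> - \<beta>)\<^sup>2) = (Re \<alpha> - Re \<beta>)\<^sup>2 - 4 * (Im \<alpha>)\<^sup>2"
    by (simp add: power2_eq_square im algebra_simps)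
  ultimately have disc: "(Re \<alpha> - Re \<beta>)\<^sup>2 - 4 * (Im \<alpha>)\<^sup>2 = of_int (A\<^sup>2 - 4 * B)" by simp
  show "\<beta> = cnj \<alpha>" if "A\<^sup>2 < 4 * B"
  proof -
    have "real_of_int (A\<^sup>2 - 4 * B) < 0" using that by (simp only: of_int_less_0_iff)
    hence "(Im \<alpha>)\<^sup>2 \<noteq> 0" using disc zero_le_power2[of "Re \<alpha> - Re \<beta>"] by linarith
    thus ?thesis using cases im by (simp add: complex_eq_iff)
  qed
  show "\<alpha> \<in> \<real> \<and> \<beta> \<in> \<real>" if "A\<^sup>2 > 4 * B"
  proof -
    have "real_of_int (A\<^sup>2 - 4 * B) > 0" using that by (simp only: of_int_0_less_iff)
    hence "(Re \<alpha> - Re \<beta>)\<^sup>2 \<noteq> 0" using disc zero_le_power2[of "Im \<alpha>"] by linarith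
    hence "Re \<beta> \<noteq> Re \<alpha>" by auto
    thus ?thesis using cases im by (simp add: complex_is_Real_iff)
  qed
qed

text \<open>With x = |a| and y = |b|, opposite signs give |a - b| = x + y, x - y = |A| \<ge> 1 and
  x^n - y^n \<ge> x^(n-2) (x^2 - y^2). Equal signs give |a - b| = x - y and x^n - y^n \<ge> x^(n-1)
  (x - y).\<close>

lemma lucas_U_real_lower_bound:
  fixes a b :: real
  assumes sum: "a + b = of_int A" and prod: "a * b = of_int B" and le: "\<bar>b\<bar> \<le> \<bar>a\<bar>"
    and ne: "a \<noteq> b" and A: "A \<noteq> 0" and n: "n \<ge> 2"
  shows "B < 0 \<Longrightarrow> \<bar>a\<bar> ^ (n - 2) \<le> \<bar>real_of_int (lucas_U A B n)\<bar>"
    and "B > 0 \<Longrightarrow> \<bar>a\<bar> ^ (n - 1) \<le> \<bar>real_of_int (lucas_U A B n)\<bar>"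
proof -
  define x y where "x = \<bar>a\<bar>" and "y = \<bar>b\<bar>"
  define u where "u = \<bar>real_of_int (lucas_U A B n)\<bar>"
  have xy: "0 \<le> y" "y \<le> x" using le by (auto simp: x_def y_def)
  have "u * \<bar>a - b\<bar> = \<bar>a ^ n - b ^ n\<bar>"
    unfolding u_def abs_mult[symmetric] lucas_U_closed_form[OF sum prod] ..
  also have "\<dots> \<ge> \<bar>a ^ n\<bar> - \<bar>b ^ n\<bar>" by (rule abs_triangle_ineq2)
  finally have u: "x ^ n - y ^ n \<le> u * \<bar>a - b\<bar>" by (simp add: x_def y_def power_abs)
  show "\<bar>a\<bar> ^ (n - 2) \<le> \<bar>real_of_int (lucas_U A B n)\<bar>" if "B < 0"
  proof -
    have "a * b < 0" using that prod by simp
    hence ab: "\<bar>a + b\<bar> = x - y" "\<bar>a - b\<bar> = x + y" "x + y > 0"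
      using le by (auto simp: mult_less_0_iff x_def y_def)
    have "1 \<le> \<bar>A\<bar>" using A by linarith
    hence "1 \<le> \<bar>a + b\<bar>" unfolding sum by linarith
    hence xy1: "1 \<le> x - y" using ab by simp
    obtain m where m: "n = m + 2" using n by (metis add.commute le_Suc_ex)
    have "y ^ m * y\<^sup>2 \<le> x ^ m * y\<^sup>2" using xy by (intro mult_right_mono power_mono) auto
    hence "x ^ m * (x - y) * (x + y) \<le> x ^ n - y ^ n"
      by (simp add: m power_add power2_eq_square algebra_simps)
    also have "\<dots> \<le> u * (x + y)" using u ab by simp
    finally have "x ^ m * (x - y) \<le> u" using ab(3) by simp
    moreover have "x ^ m * 1 \<le> x ^ m * (x - y)" using xy xy1 by (intro mult_left_mono) auto
    ultimately show ?thesis by (simp add: m x_def u_def)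
  qed
  show "\<bar>a\<bar> ^ (n - 1) \<le> \<bar>real_of_int (lucas_U A B n)\<bar>" if "B > 0"
  proof -
    have "a * b > 0" using that prod by simp
    hence ab: "\<bar>a - b\<bar> = x - y" "x - y > 0"
      using le ne by (auto simp: zero_less_mult_iff x_def y_def)
    obtain m where m: "n = Suc m" using n by (cases n) auto
    have "y ^ m * y \<le> x ^ m * y" using xy by (intro mult_right_mono power_mono) auto
    hence "x ^ m * (x - y) \<le> x ^ n - y ^ n" by (simp add: m algebra_simps)
    also have "\<dots> \<le> u * (x - y)" using u ab by simp
    finally show ?thesis using ab(2) by (simp add: m x_def u_def)
  qed
qed

section \<open>Choice of the parameters\<close>

text \<open>For h = log n the choice p = ceiling(h/2) is the least one with n \<le> e^(2p). The
  bound h > 18 forces p > 9, and the later estimate uses p \<le> h/2 + 1.\<close>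

lemma half_log_parameter:
  fixes h :: real
  assumes "h > 18"
  obtains p :: nat where "p \<ge> 10" "h \<le> 2 * real p"
    "real p * (2 * real p + 1) \<le> (h + 2) * (h + 3) / 2" "real p \<le> h"
proof
  define p where "p = nat \<lceil>h / 2\<rceil>"
  have "0 \<le> \<lceil>h / 2\<rceil>" using assms by simp
  hence p: "h / 2 \<le> real p" "real p \<le> h / 2 + 1" unfolding p_def by linarith+
  show "h \<le> 2 * real p" using p by simp
  have "9 < real p" using p assms by simp
  thus "p \<ge> 10" by simp
  have "real p * (2 * real p + 1) \<le> (h / 2 + 1) * (2 * (h / 2 + 1) + 1)"
    using p by (intro mult_mono) auto
  also have "\<dots> = (h + 2) * (h + 3) / 2" by (simp add: field_simps)
  finally show "real p * (2 * real p + 1) \<le> (h + 2) * (h + 3) / 2" .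
  show "real p \<le> h" using p assms by simp
qed

text \<open>350 = 50c for c = 7. The leading coefficient becomes 175, which leaves 75 h^2 for the
  lower-order terms.\<close>

lemma small_B_bound:
  fixes h P :: real
  assumes "h \<ge> 19" "P * (2 * P + 1) \<le> (h + 2) * (h + 3) / 2" "P \<le> h"
  shows "350 * (P * (2 * P + 1)) + P \<le> 250 * h\<^sup>2"
proof -
  have "350 * (P * (2 * P + 1)) + P \<le> 175 * ((h + 2) * (h + 3)) + h"
    using assms by simp
  also have "\<dots> = 175 * h\<^sup>2 + 876 * h + 1050" by (simp add: power2_eq_square algebra_simps)
  also have "\<dots> \<le> 175 * h\<^sup>2 + 75 * (19 * h)" using assms by simp
  also have "\<dots> \<le> 175 * h\<^sup>2 + 75 * (h * h)" using assms by (intro add_left_mono mult_left_mono mult_right_mono) auto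
  finally show ?thesis by (simp add: power2_eq_square)
qed

text \<open>For b = log B = 2 log |\<alpha>| the right-hand side is 88 h^2 log |\<alpha>|. The
  leading coefficient is 50 * 7/6 / 2 = 175/6, and 14 h^2 pays for the lower-order terms.\<close>

lemma large_B_bound:
  fixes h P b c :: real
  assumes "h \<ge> 18" "P * (2 * P + 1) \<le> (h + 2) * (h + 3) / 2" "P \<le> h" "b \<ge> 6" "0 \<le> c" "c \<le> 7 / 6 * b"
  shows "50 * c * (P * (2 * P + 1)) + P \<le> 44 * b * h\<^sup>2"
proof -
  have "50 * c * (P * (2 * P + 1)) \<le> 50 * c * ((h + 2) * (h + 3) / 2)"
    using assms by (intro mult_left_mono) auto
  also have "\<dots> \<le> 50 * (7 / 6 * b) * ((h + 2) * (h + 3) / 2)"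
    using assms by (intro mult_right_mono mult_left_mono) auto
  finally have "50 * c * (P * (2 * P + 1)) \<le> b * (175 / 6 * ((h + 2) * (h + 3)))" by simp
  moreover have "1 * h \<le> b * h" using assms by (intro mult_right_mono) auto
  hence "P \<le> b * h" using assms(3) by linarith
  ultimately have "50 * c * (P * (2 * P + 1)) + P \<le> b * (175 / 6 * ((h + 2) * (h + 3)) + h)"
    by (simp add: algebra_simps)
  also have "\<dots> \<le> b * (44 * h\<^sup>2)"
  proof (rule mult_left_mono)
    have "175 / 6 * ((h + 2) * (h + 3)) + h = 175 / 6 * h\<^sup>2 + (881 / 6 * h + 175)"
      by (simp add: power2_eq_square field_simps)
    also have "\<dots> \<le> 175 / 6 * h\<^sup>2 + 14 * (18 * h)" using assms by simp
    also have "\<dots> \<le> 175 / 6 * h\<^sup>2 + 14 * (h * h)"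
      using assms by (intro add_left_mono mult_left_mono mult_right_mono) auto
    also have "\<dots> \<le> 44 * h\<^sup>2" by (simp add: power2_eq_square)
    finally show "175 / 6 * ((h + 2) * (h + 3)) + h \<le> 44 * h\<^sup>2" .
  qed (use assms in simp)
  finally show ?thesis by simp
qed

theorem theorem2p1:
  fixes A B :: int and \<alpha> \<beta> :: complex and n :: nat
  assumes "char_roots A B \<alpha> \<beta>"
    and "cmod \<alpha> \<ge> cmod \<beta>"
    and "nondegenerate A B \<alpha> \<beta>"
    and "n \<ge> 2"
  shows "(A\<^sup>2 > 4 * B \<longrightarrow>
            (B < 0 \<longrightarrow> \<bar>real_of_int (lucas_U A B n)\<bar> \<ge> cmod \<alpha> ^ (n - 2) / 2) \<and>
            (B > 0 \<longrightarrow> \<bar>real_of_int (lucas_U A B n)\<bar> \<ge> cmod \<alpha> ^ (n - 1))) \<and>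
         (A\<^sup>2 < 4 * B \<longrightarrow>
            (B \<le> 535 \<longrightarrow> \<bar>real_of_int (lucas_U A B n)\<bar> \<ge>
               (if real n > 5 * 10 ^ 8
                then 1 / 4 * exp (- 250 * (ln (real n))\<^sup>2) * cmod \<alpha> ^ (n - 2)
                else 1 / 4 * exp (- 100000) * cmod \<alpha> ^ (n - 2))) \<and>
            (B \<ge> 536 \<longrightarrow> \<bar>real_of_int (lucas_U A B n)\<bar> \<ge>
               (if real n > 2.1 * 10 ^ 8
                then 1 / 4 * cmod \<alpha> powr (real n - 2 - 88 * (ln (real n))\<^sup>2)
                else 1 / 4 * cmod \<alpha> powr (real n - 31710))))"
proof (intro conjI impI)
  note sum = char_roots_sum_prod(1)[OF assms(1)] and prod = char_roots_sum_prod(2)[OF assms(1)]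
  have A: "A \<noteq> 0" and unity: "\<not> root_of_unity (\<alpha> / \<beta>)"
    using assms(3) by (auto simp: nondegenerate_def)
  let ?U = "\<bar>real_of_int (lucas_U A B n)\<bar>"
  {
    assume disc: "A\<^sup>2 > 4 * B"
    obtain a b where ab: "\<alpha> = of_real a" "\<beta> = of_real b"
      using char_roots_discriminant(2)[OF sum prod disc] by (auto elim!: Reals_cases)
    have "complex_of_real (a + b) = of_real (of_int A)" "complex_of_real (a * b) = of_real (of_int B)"
      using sum prod by (simp_all add: ab)
    hence real: "a + b = of_int A" "a * b = of_int B" by (simp_all only: of_real_eq_iff)
    have "a \<noteq> b"
    proof
      assume "a = b"
      hence "(of_int A :: real)\<^sup>2 = 4 * of_int B"
        unfolding real[symmetric] by (simp add: power2_eq_square)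
      hence "real_of_int (A\<^sup>2) = real_of_int (4 * B)" by simp
      thus False using disc by (simp only: of_int_eq_iff)
    qed
    note bounds = lucas_U_real_lower_bound[OF real _ this A \<open>n \<ge> 2\<close>]
    show "?U \<ge> cmod \<alpha> ^ (n - 2) / 2" if "B < 0"
    proof -
      have "\<bar>a\<bar> ^ (n - 2) / 2 \<le> \<bar>a\<bar> ^ (n - 2)" by simp
      also have "\<dots> \<le> ?U" using bounds(1) assms(2) that by (simp add: ab)
      finally show ?thesis by (simp add: ab)
    qed
    show "?U \<ge> cmod \<alpha> ^ (n - 1)" if "B > 0"
      using bounds(2) assms(2) that by (simp add: ab)
  }
  {
    assume disc: "A\<^sup>2 < 4 * B"
    define h where "h = ln (real n)"
    define r where "r = cmod \<alpha>"
    have exp_h: "real n = exp h" using assms(4) by (simp add: h_def)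
    have Bpos: "B > 0"
      using disc zero_le_power2[of A] by linarith
    note cnj = char_roots_discriminant(1)[OF sum prod disc]
    have r2: "r\<^sup>2 = of_int B"
    proof -
      have "complex_of_real (r\<^sup>2) = of_real (of_int B)"
        using prod complex_norm_square[of \<alpha>] by (simp add: r_def cnj)
      thus ?thesis by (simp only: of_real_eq_iff)
    qed
    have "1\<^sup>2 \<le> r\<^sup>2" unfolding r2 using Bpos by simp
    hence r1: "r \<ge> 1" by (rule power2_le_imp_le) (simp add: r_def)
    have bound: "1 / 4 * exp (- e) * r ^ (n - 2) \<le> ?U"
      if "p \<ge> 10" "c \<ge> 7" "of_int B \<le> exp (real c)" "real n \<le> exp (2 * real p)"
        "50 * real c * (real p * (2 * real p + 1)) + real p \<le> e" for p c :: nat and e :: real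
    proof -
      have "1 / 4 * exp (- e) * r ^ (n - 2) \<le> 1 / 4 * exp (- real (50 * c * p * (2 * p + 1) + p)) * r ^ (n - 1)"
        using that(5) r1 by (intro mult_mono power_increasing) (auto simp: algebra_simps)
      also have "\<dots> \<le> ?U" unfolding r_def
        using that assms(4) Bpos by (intro lucas_U_lower_bound[OF sum prod cnj unity]) auto
      finally show ?thesis .
    qed
    show "?U \<ge> (if real n > 5 * 10 ^ 8
                then 1 / 4 * exp (- 250 * (ln (real n))\<^sup>2) * cmod \<alpha> ^ (n - 2)
                else 1 / 4 * exp (- 100000) * cmod \<alpha> ^ (n - 2))" if "B \<le> 535"
    proof -
      have "real_of_int B \<le> 535" using that by linarith
      also have "\<dots> \<le> 2.7 ^ 7" by (simp add: power_numeral_reduce)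
      also have "\<dots> \<le> exp 7" by (rule exp_numeral_bounds)
      finally have B: "of_int B \<le> exp (real 7)" by simp
      show ?thesis
      proof (cases "real n > 5 * 10 ^ 8")
        case True
        have "exp 19 \<le> (2.72 :: real) ^ 19" by (rule exp_numeral_bounds)
        also have "\<dots> \<le> 5 * 10 ^ 8" by (simp add: power_numeral_reduce)
        finally have "exp 19 < exp h" using True unfolding exp_h by linarith
        hence h: "h \<ge> 19" by simp
        then obtain p where "p \<ge> 10" "h \<le> 2 * real p"
          "real p * (2 * real p + 1) \<le> (h + 2) * (h + 3) / 2" "real p \<le> h"
          using half_log_parameter[of h] by auto
        thus ?thesis
          using bound[of p 7 "250 * h\<^sup>2"] B True small_B_bound[OF h, of "real p"]
          by (simp add: exp_h r_def)
      next
        case False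
        have "real n \<le> 2.7 ^ 22" using False by (simp add: power_numeral_reduce)
        also have "\<dots> \<le> exp 22" by (rule exp_numeral_bounds)
        \<comment> \<open>For p = 11 and c = 7 the exponent is 350 * 253 + 11 = 88561. The value p =
          10 would not do, since e^20 is slightly below 5 * 10^8.\<close>
        finally show ?thesis using bound[of 11 7 100000] B False by (simp add: r_def)
      qed
    qed
    show "?U \<ge> (if real n > 2.1 * 10 ^ 8
                then 1 / 4 * cmod \<alpha> powr (real n - 2 - 88 * (ln (real n))\<^sup>2)
                else 1 / 4 * cmod \<alpha> powr (real n - 31710))" if "B \<ge> 536"
    proof -
      define b where "b = ln (real_of_int B)"
      \<comment> \<open>Both alternatives satisfy c \<le> 7b/6 because b \<ge> 6: then 7 \<le> 7b/6,
        and b + 1 \<le> 7b/6.\<close>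
      define c where "c = max 7 (nat \<lceil>b\<rceil>)"
      have "exp 6 \<le> (2.72 :: real) ^ 6" by (rule exp_numeral_bounds)
      also have "\<dots> \<le> 536" by (simp add: power_numeral_reduce)
      also have "\<dots> \<le> real_of_int B" using that by linarith
      also have "\<dots> = exp b" using Bpos by (simp add: b_def)
      finally have b: "b \<ge> 6" by simp
      have "0 \<le> \<lceil>b\<rceil>" using b by linarith
      hence "b \<le> real (nat \<lceil>b\<rceil>)" "real (nat \<lceil>b\<rceil>) \<le> b + 1" by linarith+
      moreover have "real c = max 7 (real (nat \<lceil>b\<rceil>))" unfolding c_def of_nat_max by (simp only: of_nat_numeral)
      ultimately have c: "b \<le> real c" "real c \<le> 7 / 6 * b" "c \<ge> 7" using b by linarith+
      have "real_of_int B = exp b" using Bpos by (simp add: b_def)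
      hence B: "of_int B \<le> exp (real c)" using c(1) by simp
      \<comment> \<open>As b/2 = log |\<alpha>|, a loss proportional to b is a power of
        |\<alpha>|.\<close>
      have powr: "r powr (real n - 2 - x) = exp (- (b / 2 * x)) * r ^ (n - 2)" for x
      proof -
        have "b = 2 * ln r" unfolding b_def r2[symmetric] using r1 by (simp add: ln_realpow)
        hence "r powr (- x) = exp (- (b / 2 * x))" using r1 by (simp add: powr_def mult.commute)
        moreover have "r powr (real n - 2) = r ^ (n - 2)"
          using r1 assms(4) powr_realpow[of r "n - 2"] by (simp add: of_nat_diff)
        moreover have "r powr (real n - 2 - x) = r powr (real n - 2) * r powr (- x)"
          by (simp flip: powr_add)
        ultimately show ?thesis by simp
      qed
      show ?thesis
      proof (cases "real n > 2.1 * 10 ^ 8")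
        case True
        have "exp 18 \<le> (2.72 :: real) ^ 18" by (rule exp_numeral_bounds)
        also have "\<dots> \<le> 2.1 * 10 ^ 8" by (simp add: power_numeral_reduce)
        finally have "exp 18 < exp h" using True unfolding exp_h by linarith
        hence h: "h > 18" by simp
        then obtain p where p: "p \<ge> 10" "h \<le> 2 * real p"
          "real p * (2 * real p + 1) \<le> (h + 2) * (h + 3) / 2" "real p \<le> h"
          by (rule half_log_parameter)
        have "50 * real c * (real p * (2 * real p + 1)) + real p \<le> 44 * b * h\<^sup>2"
          using h p b c by (intro large_B_bound) auto
        from bound[OF p(1) c(3) B _ this] p(2)
        have "1 / 4 * exp (- (44 * b * h\<^sup>2)) * r ^ (n - 2) \<le> ?U" by (simp add: exp_h)
        moreover have "b / 2 * (88 * h\<^sup>2) = 44 * b * h\<^sup>2" by simp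
        ultimately have "1 / 4 * r powr (real n - 2 - 88 * h\<^sup>2) \<le> ?U"
          unfolding powr by (simp add: mult.assoc)
        thus ?thesis using True by (simp add: r_def h_def)
      next
        case False
        have "real n \<le> 2.7 ^ 20" using False by (simp add: power_numeral_reduce)
        also have "\<dots> \<le> exp 20" by (rule exp_numeral_bounds)
        finally have "real n \<le> exp (2 * real 10)" by simp
        \<comment> \<open>31708 is 31710 less the 2 already present in the exponent n - 2.\<close>
        moreover have "50 * real c * (real 10 * (2 * real 10 + 1)) + real 10 \<le> b / 2 * 31708"
          using b c by simp
        ultimately have "1 / 4 * exp (- (b / 2 * 31708)) * r ^ (n - 2) \<le> ?U"
          using bound[of 10 c "b / 2 * 31708"] B c(3) by simp
        hence "1 / 4 * r powr (real n - 2 - 31708) \<le> ?U"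
          unfolding powr by (simp add: mult.assoc)
        thus ?thesis using False by (simp add: r_def)
      qed
    qed
  }
qed

end
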